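(* The operator $\delta$ is the adjoint of $D$: for every $F\in\mathcal{S}$ and every $G=(G_k)_{k\in\mathbb{N}}\in\mathcal{U}$, $$\mathbb{E}\left[\sum_{k=0}^\infty\langle D_kF,G_k\rangle\right]=\mathbb{E}[F\,\delta(G)].$$
   Context: Let $d\ge 1$, $\Omega=\{0,\dots,d\}^{\mathbb{N}}$ ($0\in\mathbb{N}$) with its product $\sigma$-field $\mathcal{F}$, coordinate maps $X_n(w)=w_n$, $\mathcal{F}_n=\sigma(X_0,\dots,X_n)$, $\mathcal{F}_{-1}=\{\varnothing,\Omega\}$, and a probability $\mathbb{P}$ such that $\mathbb{P}(X_n=i\,|\,\mathcal{F}_{n-1})>0$ for all $n,i$. For each $n$ let $v_0(n),\dots,v_d(n)$ be $\mathcal{F}_{n-1}$-measurable $\mathbb{R}^d$-valued random variables and $Y_n=v_{X_n}(n)$. Assume (obtuse random walk) $\sigma(Y_0,\dots,Y_n)=\mathcal{F}_n$, $\mathbb{E}[Y_n^i\,|\,\mathcal{F}_{n-1}]=0$ and $\mathbb{E}[Y_n^iY_n^j\,|\,\mathcal{F}_{n-1}]=\delta^{ij}$. $\langle\cdot,\cdot\rangle$ is the Euclidean inner product of $\mathbb{R}^d$. Multiple integrals: $\Delta_r=\{(i_1,\dots,i_r)\in\mathbb{N}^r: i_l\ne i_k \text{ for } l\neq k\}$. A function $f_r=(f_r^{k_1,\dots,k_r})_{1\le k_1,\dots,k_r\le d}:\Delta_r\to\mathbb{R}^{d^r}$ is symmetric if it is invariant under simultaneous permutation of its arguments and its upper indices.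 For symmetric square-summable $f_r\in L^2(\Delta_r,\mathbb{R}^{d^r})$, $r\ge1$, $\mathcal{I}^r(f_r)=\sum_{k_1,\dots,k_r=1}^d\sum_{(i_1,\dots,i_r)\in\Delta_r}f_r^{k_1,\dots,k_r}(i_1,\dots,i_r)Y_{i_1}^{k_1}\cdots Y_{i_r}^{k_r}$ (convergence in $L^2(\Omega)$), and $\mathcal{I}^0(f_0)=f_0\in\mathbb{R}$. $\mathcal{S}$ is the space of finite sums $\sum_{r=0}^n\mathcal{I}^r(f_r)$ with symmetric $f_r$. Gradient: $D_k=(D_k^1,\dots,D_k^d)$ is linear on $\mathcal{S}$ with $D_k^j\mathcal{I}^0(f_0)=0$ and $D_k^j\mathcal{I}^r(f_r)=r\,\mathcal{I}^{r-1}\big(f_r^j( *,k)1_{\Delta_r}( *,k)\big)$ for $r\ge1$, where $f_r^j( *,k)1_{\Delta_r}( *,k)$ is the function on $\Delta_{r-1}$ with components $(i_1,\dots,i_{r-1})\mapsto f_r^{k_1,\dots,k_{r-1},j}(i_1,\dots,i_{r-1},k)$ if $k\notin\{i_1,\dots,i_{r-1}\}$ and $0$ otherwise. Divergence: $\mathcal{U}\subset L^2(\Omega\times\mathbb{N},\mathbb{R}^d)$ is the space of processes of the form $\sum_{r=0}^n\big(\mathcal{I}^r(f_{r+1}^1( *,\cdot)),\dots,\mathcal{I}^r(f_{r+1}^d( *,\cdot))\big)$, where $f_{r+1}\in L^2(\Delta_{r+1},\mathbb{R}^{d^{r+1}})$ is symmetric in its first $r$ variables (jointly with the first $r$ upper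 indices) and $f_{r+1}^i( *,k)$ has components $(i_1,\dots,i_r)\mapsto f_{r+1}^{k_1,\dots,k_r,i}(i_1,\dots,i_r,k)$ (taken as $0$ if $k\in\{i_1,\dots,i_r\}$). $\delta:\mathcal{U}\to L^2(\Omega)$ is the linear map sending the process $X_k=\big(\mathcal{I}^r(f_{r+1}^1( *,k)),\dots,\mathcal{I}^r(f_{r+1}^d( *,k))\big)$ to $\delta(X)=\mathcal{I}^{r+1}(\widetilde f_{r+1})$, where $\widetilde f_n^{i_1,\dots,i_n}(t_1,\dots,t_n)=\frac1{n!}\sum_{\sigma}f_n^{i_{\sigma(1)},\dots,i_{\sigma(n)}}(t_{\sigma(1)},\dots,t_{\sigma(n)})$, the sum being over all permutations $\sigma$ of $\{1,\dots,n\}$. *)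

theory Defs
  imports "HOL-Probability.Probability" "HOL-Combinatorics.Combinatorics"
begin

text \<open>
  The dimension is \<open>d = CARD('d)\<close>; points of the sample space are maps \<open>w :: nat \<Rightarrow> nat\<close> with
  values in \<open>{0..d}\<close>, and the coordinate \<open>X\<^sub>n\<close> is \<open>\<lambda>w. w n\<close>.
  Random variables are functions; identities in \<open>L\<^sup>2\<close> are stated almost everywhere.
\<close>

definition sequence_space :: "'d::finite itself \<Rightarrow> (nat \<Rightarrow> nat) measure" where
  "sequence_space _ = PiM UNIV (\<lambda>_. count_space {0..CARD('d)})"

definition generated_by :: "'w set \<Rightarrow> 'a measure \<Rightarrow> (nat \<Rightarrow> 'w \<Rightarrow> 'a) \<Rightarrow> nat set \<Rightarrow> 'w measure" where
  "generated_by \<Omega> N Z I = sigma \<Omega> {Z i -` A \<inter> \<Omega> |i A. i \<in> I \<and> A \<in> sets N}"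

definition coord_algebra :: "(nat \<Rightarrow> nat) measure \<Rightarrow> nat set \<Rightarrow> (nat \<Rightarrow> nat) measure" where
  "coord_algebra P I = generated_by (space P) (count_space UNIV) (\<lambda>n w. w n) I"

text \<open>\<open>\<F>\<^sub>n\<close> is \<open>coord_algebra P {..n}\<close> and \<open>\<F>\<^bsub>n-1\<^esub>\<close> is \<open>coord_algebra P {..<n}\<close>, which is trivial
  for \<open>n = 0\<close>.\<close>

definition walk :: "(nat \<Rightarrow> nat \<Rightarrow> (nat \<Rightarrow> nat) \<Rightarrow> real^'d) \<Rightarrow> nat \<Rightarrow> (nat \<Rightarrow> nat) \<Rightarrow> real^'d" where
  "walk v n w = v (w n) n w"

locale obtuse_random_walk = prob_space P
  for P :: "(nat \<Rightarrow> nat) measure" +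
  fixes v :: "nat \<Rightarrow> nat \<Rightarrow> (nat \<Rightarrow> nat) \<Rightarrow> real^'d::finite"
  assumes sets_P: "sets P = sets (sequence_space TYPE('d))"
    and cond_prob_pos: "\<And>n i. i \<le> CARD('d) \<Longrightarrow>
      AE w in P. real_cond_exp P (coord_algebra P {..<n}) (indicator {w \<in> space P. w n = i}) w > 0"
    and v_measurable: "\<And>i n. i \<le> CARD('d) \<Longrightarrow> v i n \<in> borel_measurable (coord_algebra P {..<n})"
    and sigma_walk: "\<And>n. sets (generated_by (space P) borel (walk v) {..n}) = sets (coord_algebra P {..n})"
    and walk_centered: "\<And>n i.
      AE w in P. real_cond_exp P (coord_algebra P {..<n}) (\<lambda>w. walk v n w $ i) w = 0"
    and walk_normalized: "\<And>n i j.
      AE w in P. real_cond_exp P (coord_algebra P {..<n}) (\<lambda>w. walk v n w $ i * walk v n w $ j) w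
        = (if i = j then 1 else 0)"

definition L2 :: "'w measure \<Rightarrow> ('w \<Rightarrow> 'b::euclidean_space) set" where
  "L2 M = {g \<in> borel_measurable M. integrable M (\<lambda>x. (norm (g x))\<^sup>2)}"

text \<open>A kernel \<open>f\<close> of arity \<open>r\<close> is evaluated as \<open>f [k\<^sub>1,\<dots>,k\<^sub>r] [i\<^sub>1,\<dots>,i\<^sub>r]\<close>; only its values on
  \<open>upper r \<times> Delta r\<close> are relevant.\<close>

type_synonym 'd kernel = "'d list \<Rightarrow> nat list \<Rightarrow> real"

definition Delta :: "nat \<Rightarrow> nat list set" where
  "Delta r = {ts. length ts = r \<and> distinct ts}"

definition upper :: "nat \<Rightarrow> 'd::finite list set" where
  "upper r = {ks. length ks = r}"

text \<open>Symmetry in the first \<open>m\<close> of \<open>r\<close> variables: a permutation of \<open>{..<m}\<close> fixes the remaining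
  positions.\<close>

definition symmetric_in :: "nat \<Rightarrow> nat \<Rightarrow> 'd::finite kernel \<Rightarrow> bool" where
  "symmetric_in m r f \<longleftrightarrow> (\<forall>ks\<in>upper r. \<forall>ts\<in>Delta r. \<forall>\<sigma>. \<sigma> permutes {..<m} \<longrightarrow>
     f (permute_list \<sigma> ks) (permute_list \<sigma> ts) = f ks ts)"

abbreviation symmetric_kernel :: "nat \<Rightarrow> 'd::finite kernel \<Rightarrow> bool" where
  "symmetric_kernel r \<equiv> symmetric_in r r"

definition square_summable :: "nat \<Rightarrow> 'd::finite kernel \<Rightarrow> bool" where
  "square_summable r f \<longleftrightarrow> (\<lambda>ts. \<Sum>ks\<in>upper r. (f ks ts)\<^sup>2) summable_on Delta r"

definition symmetrize :: "nat \<Rightarrow> 'd kernel \<Rightarrow> 'd kernel" where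
  "symmetrize n f ks ts =
     1 / fact n * (\<Sum>\<sigma> | \<sigma> permutes {..<n}. f (permute_list \<sigma> ks) (permute_list \<sigma> ts))"

definition slice :: "'d kernel \<Rightarrow> 'd \<Rightarrow> nat \<Rightarrow> 'd kernel" where
  "slice f j k ks ts = (if k \<in> set ts then 0 else f (ks @ [j]) (ts @ [k]))"

definition partial_integral ::
    "(nat \<Rightarrow> 'w \<Rightarrow> real^'d::finite) \<Rightarrow> nat \<Rightarrow> 'd kernel \<Rightarrow> nat list set \<Rightarrow> 'w \<Rightarrow> real" where
  "partial_integral Y r f A w =
     (\<Sum>ks\<in>upper r. \<Sum>ts\<in>A. f ks ts * (\<Prod>l<r. Y (ts ! l) w $ (ks ! l)))"

text \<open>The sum over \<open>Delta r\<close> is unconditional: the limit is taken in \<open>L\<^sup>2\<close> along the finite subsets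
  of \<open>Delta r\<close>. It is unique up to null sets; one version is chosen.\<close>

definition multiple_integral ::
    "'w measure \<Rightarrow> (nat \<Rightarrow> 'w \<Rightarrow> real^'d::finite) \<Rightarrow> nat \<Rightarrow> 'd kernel \<Rightarrow> 'w \<Rightarrow> real" where
  "multiple_integral P Y r f =
     (if r = 0 then (\<lambda>_. f [] [])
      else (SOME Z. Z \<in> L2 P \<and>
        ((\<lambda>A. \<integral>w. (Z w - partial_integral Y r f A w)\<^sup>2 \<partial>P) \<longlongrightarrow> 0) (finite_subsets_at_top (Delta r))))"

definition chaos_expansion ::
    "'w measure \<Rightarrow> (nat \<Rightarrow> 'w \<Rightarrow> real^'d::finite) \<Rightarrow> ('w \<Rightarrow> real) \<Rightarrow> nat \<Rightarrow> (nat \<Rightarrow> 'd kernel) \<Rightarrow> bool" where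
  "chaos_expansion P Y F n f \<longleftrightarrow>
     (\<forall>r\<le>n. symmetric_kernel r (f r) \<and> square_summable r (f r)) \<and>
     (AE w in P. F w = (\<Sum>r\<le>n. multiple_integral P Y r (f r) w))"

definition chaos_space :: "'w measure \<Rightarrow> (nat \<Rightarrow> 'w \<Rightarrow> real^'d::finite) \<Rightarrow> ('w \<Rightarrow> real) set" where
  "chaos_space P Y = {F \<in> L2 P. \<exists>n f. chaos_expansion P Y F n f}"

text \<open>The kernels of an element of \<open>chaos_space\<close> are determined on the sets \<open>Delta r\<close> (up to
  appending zero kernels) by the isometry property of the multiple integrals. Hence the value of
  the gradient does not depend, up to null sets, on the expansion chosen below, and the gradient is
  the linear extension of its action on multiple integrals. The same applies to the divergence.\<close>

definition gradient ::
    "'w measure \<Rightarrow> (nat \<Rightarrow> 'w \<Rightarrow> real^'d::finite) \<Rightarrow> ('w \<Rightarrow> real) \<Rightarrow> nat \<Rightarrow> 'w \<Rightarrow> real^'d" where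
  "gradient P Y F =
     (let (n, f) = (SOME (n, f). chaos_expansion P Y F n f)
      in (\<lambda>k w. \<chi> j. \<Sum>r=1..n. real r * multiple_integral P Y (r - 1) (slice (f r) j k) w))"

text \<open>Here \<open>f r\<close> is the kernel \<open>f\<^bsub>r+1\<^esub>\<close> of arity \<open>r + 1\<close>, whose last variable is the time of the
  process.\<close>

definition process_expansion ::
    "'w measure \<Rightarrow> (nat \<Rightarrow> 'w \<Rightarrow> real^'d::finite) \<Rightarrow> (nat \<Rightarrow> 'w \<Rightarrow> real^'d) \<Rightarrow> nat \<Rightarrow> (nat \<Rightarrow> 'd kernel) \<Rightarrow> bool" where
  "process_expansion P Y G n f \<longleftrightarrow>
     (\<forall>r\<le>n. symmetric_in r (Suc r) (f r) \<and> square_summable (Suc r) (f r)) \<and>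
     (\<forall>k. AE w in P. G k w = (\<chi> j. \<Sum>r\<le>n. multiple_integral P Y r (slice (f r) j k) w))"

definition process_space ::
    "'w measure \<Rightarrow> (nat \<Rightarrow> 'w \<Rightarrow> real^'d::finite) \<Rightarrow> (nat \<Rightarrow> 'w \<Rightarrow> real^'d) set" where
  "process_space P Y = {G. (\<lambda>(w, k). G k w) \<in> L2 (P \<Otimes>\<^sub>M count_space UNIV) \<and>
     (\<exists>n f. process_expansion P Y G n f)}"

definition divergence ::
    "'w measure \<Rightarrow> (nat \<Rightarrow> 'w \<Rightarrow> real^'d::finite) \<Rightarrow> (nat \<Rightarrow> 'w \<Rightarrow> real^'d) \<Rightarrow> 'w \<Rightarrow> real" where
  "divergence P Y G =
     (let (n, f) = (SOME (n, f). process_expansion P Y G n f)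
      in (\<lambda>w. \<Sum>r\<le>n. multiple_integral P Y (Suc r) (symmetrize (Suc r) (f r)) w))"

end

theory Submission imports Defs begin

text \<open>
  For distinct times, the product of the \<open>Y\<^bsub>t\<^esub>\<close>-components with upper indices \<open>ks\<close> at times \<open>ts\<close>
  depends only on the multiset of the pairs in \<open>zip ts ks\<close>. Conditioning on the last time shows that
  products with different multisets are orthogonal and that each has norm 1
  (\<open>integral_monomial_mult\<close>). An order \<open>r\<close> monomial is therefore hit by exactly \<open>r!\<close> terms of the
  series that defines \<open>\<I>\<^sup>r(g)\<close>, namely those obtained by permuting its index, and pairing it with
  \<open>\<I>\<^sup>r(g)\<close> gives \<open>r!\<close> times the symmetrization of \<open>g\<close> at that index
  (\<open>integral_multiple_mult_monomial\<close>). Integrating against \<open>\<I>\<^sup>r(f)\<close> term by term,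
  \<open>E[\<I>\<^sup>r(f) \<I>\<^sup>s(g)]\<close> is \<open>r! \<langle>f, sym g\<rangle>\<close> for \<open>r = s\<close> and 0 otherwise, for all square summable
  kernels (\<open>integral_multiple_mult_has_sum\<close>). The existence of the multiple integrals rests on the same count, in the form \<open>E[(\<Sum>\<dots>)\<^sup>2] \<le> r! \<Sum>f\<^sup>2\<close> for finite partial sums,
  and on the completeness of \<open>L\<^sup>2\<close>.

  Given this isometry, the duality formula for \<open>F = \<I>\<^sup>r\<^sup>+\<^sup>1(f)\<close> and \<open>G = \<I>\<^sup>s(g(*,\<cdot>))\<close> compares two
  evaluations of one series. Both sides vanish unless \<open>r = s\<close>. In that case the right-hand side is
  \<open>(r+1)! \<langle>f, sym g\<rangle> = (r+1)! \<langle>f, g\<rangle>\<close>, as \<open>f\<close> is symmetric, and the left-hand side is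
  \<open>(r+1) \<Sum>\<^sub>k \<Sum>\<^sub>j r! \<langle>f\<^sup>j(*,k), g\<^sup>j(*,k)\<rangle>\<close>, which is the same series summed first over
  the indices other than the last one (\<open>has_sum_Delta_Suc\<close>, \<open>multiple_integral_duality\<close>).

  For finite sums of multiple integrals, bilinearity reduces the claim to these terms
  (\<open>expansion_duality\<close>). The exchange of \<open>E\<close> with the sum over the times \<open>k\<close> is justified because
  both \<open>E|D\<^sub>kF|\<^sup>2\<close> and \<open>E|G\<^sub>k|\<^sup>2\<close> are summable in \<open>k\<close>, again by slicing (\<open>summable_process_norms\<close>). The
  argument applies to every expansion of \<open>F\<close> and \<open>G\<close>, in particular to the ones on which
  \<open>gradient\<close> and \<open>divergence\<close> are evaluated.
\<close>

section \<open>Square integrable random variables\<close>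

lemma L2_real_iff:
  fixes g :: "'w \<Rightarrow> real"
  shows "g \<in> L2 M \<longleftrightarrow> g \<in> borel_measurable M \<and> integrable M (\<lambda>x. (g x)\<^sup>2)"
  by (simp add: L2_def)

lemma L2_measurable: "g \<in> L2 M \<Longrightarrow> g \<in> borel_measurable M"
  by (simp add: L2_def)

lemma L2_mult_integrable:
  fixes f g :: "'w \<Rightarrow> real"
  assumes "f \<in> L2 M" "g \<in> L2 M"
  shows "integrable M (\<lambda>x. f x * g x)"
proof (rule Bochner_Integration.integrable_bound)
  show "integrable M (\<lambda>x. (f x)\<^sup>2 + (g x)\<^sup>2)"
    using assms by (simp add: L2_real_iff)
  show "(\<lambda>x. f x * g x) \<in> borel_measurable M"
    using assms by (auto simp: L2_real_iff)
  show "AE x in M. norm (f x * g x) \<le> norm ((f x)\<^sup>2 + (g x)\<^sup>2)"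
  proof (rule AE_I2)
    fix x
    have "0 \<le> (\<bar>f x\<bar> - \<bar>g x\<bar>)\<^sup>2" by simp
    hence "2 * \<bar>f x * g x\<bar> \<le> (f x)\<^sup>2 + (g x)\<^sup>2"
      by (simp add: power2_diff abs_mult)
    thus "norm (f x * g x) \<le> norm ((f x)\<^sup>2 + (g x)\<^sup>2)" by simp
  qed
qed

lemma L2_add:
  fixes f g :: "'w \<Rightarrow> real"
  assumes "f \<in> L2 M" "g \<in> L2 M"
  shows "(\<lambda>x. f x + g x) \<in> L2 M"
  using assms L2_mult_integrable[OF assms]
  by (auto simp: L2_real_iff power2_sum mult.assoc)

lemma L2_cmult:
  fixes f :: "'w \<Rightarrow> real"
  assumes "f \<in> L2 M"
  shows "(\<lambda>x. c * f x) \<in> L2 M"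
  using assms by (auto simp: L2_real_iff power_mult_distrib)

lemma L2_diff:
  fixes f g :: "'w \<Rightarrow> real"
  assumes "f \<in> L2 M" "g \<in> L2 M"
  shows "(\<lambda>x. f x - g x) \<in> L2 M"
  using L2_add[OF assms(1) L2_cmult[OF assms(2), of "-1"]] by simp

lemma L2_sum:
  fixes f :: "'i \<Rightarrow> 'w \<Rightarrow> real"
  assumes "\<And>i. i \<in> I \<Longrightarrow> f i \<in> L2 M"
  shows "(\<lambda>x. \<Sum>i\<in>I. f i x) \<in> L2 M"
  using assms
proof (induction I rule: infinite_finite_induct)
  case (insert i I)
  thus ?case by (simp add: L2_add)
qed (simp_all add: L2_real_iff)

lemma L2_Cauchy_Schwarz:
  fixes f g :: "'w \<Rightarrow> real"
  assumes f: "f \<in> L2 M" and g: "g \<in> L2 M"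
  shows "(\<integral>x. f x * g x \<partial>M)\<^sup>2 \<le> (\<integral>x. (f x)\<^sup>2 \<partial>M) * (\<integral>x. (g x)\<^sup>2 \<partial>M)"
proof -
  define a b c where "a = (\<integral>x. (f x)\<^sup>2 \<partial>M)" and "b = (\<integral>x. f x * g x \<partial>M)"
    and "c = (\<integral>x. (g x)\<^sup>2 \<partial>M)"
  have int: "integrable M (\<lambda>x. (f x)\<^sup>2)" "integrable M (\<lambda>x. (g x)\<^sup>2)" "integrable M (\<lambda>x. f x * g x)"
    using f g L2_mult_integrable[OF f g] by (auto simp: L2_real_iff)
  have quad: "0 \<le> s\<^sup>2 * a + 2 * s * t * b + t\<^sup>2 * c" for s t
  proof -
    have "0 \<le> (\<integral>x. (s * f x + t * g x)\<^sup>2 \<partial>M)" by simp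
    also have "(\<lambda>x. (s * f x + t * g x)\<^sup>2) =
        (\<lambda>x. s\<^sup>2 * (f x)\<^sup>2 + 2 * s * t * (f x * g x) + t\<^sup>2 * (g x)\<^sup>2)"
      by (auto simp: power2_eq_square algebra_simps)
    finally show ?thesis
      using int by (simp add: a_def b_def c_def)
  qed
  have ac: "0 \<le> a" "0 \<le> c" by (simp_all add: a_def c_def)
  have "b\<^sup>2 \<le> a * c"
  proof (cases "c = 0")
    case True
    have "b = 0"
    proof (rule ccontr)
      assume "b \<noteq> 0"
      \<comment> \<open>With \<open>c = 0\<close> the form is affine in \<open>t\<close>; this \<open>t\<close> makes it equal to \<open>-1\<close>.\<close>
      have "0 \<le> 1\<^sup>2 * a + 2 * 1 * (- (a + 1) / (2 * b)) * b + (- (a + 1) / (2 * b))\<^sup>2 * c"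
        by (rule quad)
      hence "0 \<le> a + (- (2 * a) - 2) / 2" using \<open>b \<noteq> 0\<close> True by simp
      thus False by argo
    qed
    thus ?thesis using ac by simp
  next
    case False
    have "0 \<le> c\<^sup>2 * a + 2 * c * (- b) * b + (- b)\<^sup>2 * c" by (rule quad)
    hence "0 \<le> c * (a * c - b\<^sup>2)" by (simp add: algebra_simps power2_eq_square)
    thus ?thesis using False ac by (simp add: zero_le_mult_iff)
  qed
  thus ?thesis by (simp add: a_def b_def c_def)
qed

lemma L2_integral_diff_square_le:
  fixes f g :: "'w \<Rightarrow> real"
  assumes "f \<in> L2 M" "g \<in> L2 M"
  shows "(\<integral>w. (f w - g w)\<^sup>2 \<partial>M) \<le> 2 * (\<integral>w. (f w)\<^sup>2 \<partial>M) + 2 * (\<integral>w. (g w)\<^sup>2 \<partial>M)"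
proof -
  have "(\<integral>w. (f w - g w)\<^sup>2 \<partial>M) \<le> (\<integral>w. 2 * (f w)\<^sup>2 + 2 * (g w)\<^sup>2 \<partial>M)"
  proof (rule integral_mono)
    fix w
    have "0 \<le> (f w + g w)\<^sup>2" by simp
    thus "(f w - g w)\<^sup>2 \<le> 2 * (f w)\<^sup>2 + 2 * (g w)\<^sup>2" by (simp add: power2_sum power2_diff)
  qed (use assms L2_diff[OF assms] in \<open>auto simp: L2_real_iff\<close>)
  thus ?thesis using assms by (simp add: L2_real_iff)
qed

text \<open>
  Strong convergence implies weak convergence, along an arbitrary filter: the multiple integrals are limits along the finite subsets of the index set, not along a sequence.
\<close>

lemma tendsto_integral_mult_L2:
  fixes u :: "'i \<Rightarrow> 'w \<Rightarrow> real"
  assumes Z: "Z \<in> L2 M" and W: "W \<in> L2 M" and u: "\<And>A. u A \<in> L2 M"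
    and lim: "((\<lambda>A. \<integral>x. (Z x - u A x)\<^sup>2 \<partial>M) \<longlongrightarrow> 0) \<A>"
  shows "((\<lambda>A. \<integral>x. u A x * W x \<partial>M) \<longlongrightarrow> (\<integral>x. Z x * W x \<partial>M)) \<A>"
proof -
  let ?c = "\<integral>x. (W x)\<^sup>2 \<partial>M"
  have eq: "(\<integral>x. Z x * W x \<partial>M) - (\<integral>x. u A x * W x \<partial>M) = (\<integral>x. (Z x - u A x) * W x \<partial>M)" for A
    by (simp add: left_diff_distrib L2_mult_integrable Z W u)
  have "((\<lambda>A. sqrt ((\<integral>x. (Z x - u A x)\<^sup>2 \<partial>M) * ?c)) \<longlongrightarrow> sqrt (0 * ?c)) \<A>"
    by (intro tendsto_intros lim)
  hence lim0: "((\<lambda>A. sqrt ((\<integral>x. (Z x - u A x)\<^sup>2 \<partial>M) * ?c)) \<longlongrightarrow> 0) \<A>" by simp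
  have "((\<lambda>A. (\<integral>x. Z x * W x \<partial>M) - (\<integral>x. u A x * W x \<partial>M)) \<longlongrightarrow> 0) \<A>"
  proof (rule Lim_null_comparison[OF always_eventually lim0], rule allI)
    fix A
    show "norm ((\<integral>x. Z x * W x \<partial>M) - (\<integral>x. u A x * W x \<partial>M))
        \<le> sqrt ((\<integral>x. (Z x - u A x)\<^sup>2 \<partial>M) * ?c)"
      using L2_Cauchy_Schwarz[OF L2_diff[OF Z u] W]
      by (simp add: eq real_le_rsqrt)
  qed
  from tendsto_diff[OF tendsto_const this, of "\<integral>x. Z x * W x \<partial>M"] show ?thesis by simp
qed

text \<open>
  By monotone convergence, \<open>\<Sum>\<^sub>k |f\<^sub>k|\<close> has finite integral and so is finite almost everywhere.
\<close>

lemma AE_summable_of_summable_integral: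
  fixes f :: "nat \<Rightarrow> 'w \<Rightarrow> real"
  assumes f: "\<And>k. integrable M (f k)" and summ: "summable (\<lambda>k. \<integral>x. \<bar>f k x\<bar> \<partial>M)"
  shows "AE x in M. summable (\<lambda>k. \<bar>f k x\<bar>)"
proof -
  have [measurable]: "f k \<in> borel_measurable M" for k using f by auto
  have "(\<integral>\<^sup>+x. (\<Sum>k. ennreal \<bar>f k x\<bar>) \<partial>M) = (\<Sum>k. \<integral>\<^sup>+x. ennreal \<bar>f k x\<bar> \<partial>M)"
    by (rule nn_integral_suminf) measurable
  also have "\<dots> = (\<Sum>k. ennreal (\<integral>x. \<bar>f k x\<bar> \<partial>M))"
    using f by (intro suminf_cong nn_integral_eq_integral) auto
  also have "\<dots> = ennreal (\<Sum>k. \<integral>x. \<bar>f k x\<bar> \<partial>M)"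
    by (rule suminf_ennreal2) (auto intro: summ)
  finally have "(\<integral>\<^sup>+x. (\<Sum>k. ennreal \<bar>f k x\<bar>) \<partial>M) \<noteq> \<infinity>" by simp
  hence "AE x in M. (\<Sum>k. ennreal \<bar>f k x\<bar>) \<noteq> \<infinity>"
    by (intro nn_integral_PInf_AE) measurable
  thus ?thesis
    by eventually_elim (auto intro: summable_suminf_not_top)
qed

lemma (in prob_space) L2_integral_abs_le:
  fixes f :: "'a \<Rightarrow> real"
  assumes "f \<in> L2 M" and "(\<integral>x. (f x)\<^sup>2 \<partial>M) \<le> c\<^sup>2" and "0 \<le> c"
  shows "(\<integral>x. \<bar>f x\<bar> \<partial>M) \<le> c"
proof -
  have "(\<lambda>x. \<bar>f x\<bar>) \<in> L2 M" "(\<lambda>x. 1::real) \<in> L2 M"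
    using assms by (auto simp: L2_real_iff)
  from L2_Cauchy_Schwarz[OF this] have "(\<integral>x. \<bar>f x\<bar> \<partial>M)\<^sup>2 \<le> (\<integral>x. (f x)\<^sup>2 \<partial>M)"
    by (simp add: prob_space)
  with assms show ?thesis by (meson order_trans power2_le_imp_le)
qed

text \<open>
  The Riesz-Fischer theorem. A subsequence with increments at most \<open>2\<^sup>-\<^sup>k\<close> in norm converges almost
  everywhere, since its increments are summable in \<open>L\<^sup>1\<close>.
\<close>

lemma (in prob_space) L2_complete:
  fixes u :: "nat \<Rightarrow> 'a \<Rightarrow> real"
  assumes u: "\<And>n. u n \<in> L2 M"
    and cauchy: "\<And>e. e > 0 \<Longrightarrow> \<exists>N. \<forall>m\<ge>N. \<forall>n\<ge>N. (\<integral>x. (u m x - u n x)\<^sup>2 \<partial>M) \<le> e"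
  obtains Z where "Z \<in> L2 M" "(\<lambda>n. \<integral>x. (Z x - u n x)\<^sup>2 \<partial>M) \<longlonglongrightarrow> 0"
proof -
  have um[measurable]: "u n \<in> borel_measurable M" for n using u by (rule L2_measurable)
  define c :: "nat \<Rightarrow> real" where "c k = (1/2)^k" for k
  have c: "c k > 0" for k by (simp add: c_def)
  have "\<exists>N. \<forall>m\<ge>N. \<forall>n\<ge>N. (\<integral>x. (u m x - u n x)\<^sup>2 \<partial>M) \<le> (c k)\<^sup>2" for k
    using c[of k] by (intro cauchy) auto
  then obtain N where N: "\<And>k m n. N k \<le> m \<Longrightarrow> N k \<le> n \<Longrightarrow> (\<integral>x. (u m x - u n x)\<^sup>2 \<partial>M) \<le> (c k)\<^sup>2"
    by metis
  \<comment> \<open>The sum stands in for the maximum of the \<open>N j\<close>; \<open>s\<close> need not be strictly increasing.\<close>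
  define s where "s k = (\<Sum>j\<le>k. N j)" for k
  have s: "N j \<le> s k" if "j \<le> k" for j k
    unfolding s_def using that by (intro member_le_sum) auto
  define d where "d k x = u (s (Suc k)) x - u (s k) x" for k x
  have d: "d k \<in> L2 M" for k unfolding d_def by (intro L2_diff u)
  have d_int: "integrable M (d k)" for k
    using d[of k] by (simp add: L2_real_iff square_integrable_imp_integrable)
  have d_bound: "(\<integral>x. \<bar>d k x\<bar> \<partial>M) \<le> c k" for k
    using d c[of k] N[OF s s, of k "Suc k" k]
    by (intro L2_integral_abs_le[OF d]) (simp_all add: d_def)
  have "summable (\<lambda>k. \<integral>x. \<bar>d k x\<bar> \<partial>M)"
  proof (rule summable_comparison_test')
    show "summable c" unfolding c_def[abs_def] by (simp add: summable_geometric)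
  qed (use d_bound in simp)
  from AE_summable_of_summable_integral[OF d_int this]
  have conv: "AE x in M. convergent (\<lambda>k. u (s k) x)"
  proof eventually_elim
    case (elim x)
    have "summable (\<lambda>k. d k x)" using elim by (simp add: summable_rabs_cancel)
    hence "convergent (\<lambda>n. (\<Sum>k<n. d k x))" by (simp add: summable_iff_convergent)
    moreover have "(\<Sum>k<n. d k x) = u (s n) x - u (s 0) x" for n
      unfolding d_def by (induction n) auto
    ultimately have "convergent (\<lambda>n. u (s n) x - u (s 0) x)" by simp
    from convergent_add[OF this convergent_const[of "u (s 0) x"]] show ?case by simp
  qed
  define Z where "Z x = lim (\<lambda>k. u (s k) x)" for x
  have [measurable]: "Z \<in> borel_measurable M" unfolding Z_def by measurable
  have Z_lim: "AE x in M. (\<lambda>k. u (s k) x) \<longlonglongrightarrow> Z x"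
    using conv by eventually_elim (simp add: Z_def convergent_LIMSEQ_iff)
  \<comment> \<open>Fatou's lemma turns the Cauchy estimate along the subsequence into a bound for the limit.\<close>
  have fatou: "(\<integral>\<^sup>+x. ennreal ((Z x - u n x)\<^sup>2) \<partial>M) \<le> ennreal ((c k)\<^sup>2)" if n: "N k \<le> n" for n k
  proof -
    have "(\<integral>\<^sup>+x. ennreal ((Z x - u n x)\<^sup>2) \<partial>M)
        = (\<integral>\<^sup>+x. liminf (\<lambda>m. ennreal ((u (s m) x - u n x)\<^sup>2)) \<partial>M)"
    proof (rule nn_integral_cong_AE)
      show "AE x in M. ennreal ((Z x - u n x)\<^sup>2) = liminf (\<lambda>m. ennreal ((u (s m) x - u n x)\<^sup>2))"
        using Z_lim
      proof eventually_elim
        case (elim x)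
        hence "(\<lambda>m. ennreal ((u (s m) x - u n x)\<^sup>2)) \<longlonglongrightarrow> ennreal ((Z x - u n x)\<^sup>2)"
          by (intro tendsto_intros)
        thus ?case by (rule lim_imp_Liminf[OF sequentially_bot, symmetric])
      qed
    qed
    also have "\<dots> \<le> liminf (\<lambda>m. \<integral>\<^sup>+x. ennreal ((u (s m) x - u n x)\<^sup>2) \<partial>M)"
      by (rule nn_integral_liminf) measurable
    also have "\<dots> \<le> liminf (\<lambda>m::nat. ennreal ((c k)\<^sup>2))"
    proof (rule Liminf_mono)
      have "(\<integral>\<^sup>+x. ennreal ((u (s m) x - u n x)\<^sup>2) \<partial>M) \<le> ennreal ((c k)\<^sup>2)" if "m \<ge> k" for m
      proof -
        have "integrable M (\<lambda>x. (u (s m) x - u n x)\<^sup>2)"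
          using L2_diff[OF u u] by (simp add: L2_real_iff)
        thus ?thesis
          using N[OF s n, OF that] by (subst nn_integral_eq_integral) (auto intro: ennreal_leI)
      qed
      thus "\<forall>\<^sub>F m in sequentially. (\<integral>\<^sup>+x. ennreal ((u (s m) x - u n x)\<^sup>2) \<partial>M) \<le> ennreal ((c k)\<^sup>2)"
        by (auto simp: eventually_sequentially)
    qed
    also have "\<dots> = ennreal ((c k)\<^sup>2)" by (simp add: Liminf_const)
    finally show ?thesis .
  qed
  have int: "integrable M (\<lambda>x. (Z x - u n x)\<^sup>2)" if "N k \<le> n" for n k
    using fatou[OF that]
    by (intro integrableI_bounded) (auto intro: le_less_trans)
  have bound: "(\<integral>x. (Z x - u n x)\<^sup>2 \<partial>M) \<le> (c k)\<^sup>2" if "N k \<le> n" for n k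
    using fatou[OF that] int[OF that] by (simp add: nn_integral_eq_integral)
  have "(\<lambda>x. Z x - u (N 0) x) \<in> L2 M"
    using int[of 0 "N 0"] by (simp add: L2_real_iff)
  from L2_add[OF this u[of "N 0"]] have "Z \<in> L2 M" by simp
  moreover have "(\<lambda>n. \<integral>x. (Z x - u n x)\<^sup>2 \<partial>M) \<longlonglongrightarrow> 0"
  proof (rule LIMSEQ_I)
    fix e :: real assume "e > 0"
    moreover have "(\<lambda>k. (c k)\<^sup>2) \<longlonglongrightarrow> 0"
      unfolding c_def by (auto intro!: LIMSEQ_power_zero tendsto_eq_intros)
    ultimately have "\<forall>\<^sub>F k in sequentially. (c k)\<^sup>2 < e" by (rule order_tendstoD(2)[rotated])
    then obtain k where "(c k)\<^sup>2 < e" by (auto simp: eventually_sequentially)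
    thus "\<exists>no. \<forall>n\<ge>no. norm ((\<integral>x. (Z x - u n x)\<^sup>2 \<partial>M) - 0) < e"
      using bound by (intro exI[of _ "N k"]) (auto intro: le_less_trans)
  qed
  ultimately show thesis by (rule that)
qed

section \<open>Orthonormality of the monomials\<close>

definition monomial :: "(nat \<Rightarrow> 'w \<Rightarrow> real^'d::finite) \<Rightarrow> nat \<Rightarrow> 'd list \<Rightarrow> nat list \<Rightarrow> 'w \<Rightarrow> real" where
  "monomial Y r ks ts w = (\<Prod>l<r. Y (ts ! l) w $ (ks ! l))"

text \<open>
  With the convention \<open>Y\<^sub>t\<^sup>0 = 1\<close>, encoded by \<open>None\<close>, a monomial becomes a product over \<^emph>\<open>all\<close> times
  below a bound. The two conditions on the walk, centering and normalization, then become one: the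
  components \<open>Y\<^sub>t\<^sup>0,\<dots>,Y\<^sub>t\<^sup>d\<close> are conditionally orthonormal (\<open>integral_mult_augmented\<close>).
\<close>

definition augmented :: "(nat \<Rightarrow> 'w \<Rightarrow> real^'d::finite) \<Rightarrow> nat \<Rightarrow> 'd option \<Rightarrow> 'w \<Rightarrow> real" where
  "augmented Y t a w = (case a of None \<Rightarrow> 1 | Some k \<Rightarrow> Y t w $ k)"

lemma prod_augmented_eq_monomial:
  assumes len: "length ks = r" "length ts = r" and dist: "distinct ts" and sub: "set ts \<subseteq> {..<N}"
  shows "(\<Prod>t<N. augmented Y t (map_of (zip ts ks) t) w) = monomial Y r ks ts w"
proof -
  have "(\<Prod>t<N. augmented Y t (map_of (zip ts ks) t) w)
      = (\<Prod>t\<in>set ts. augmented Y t (map_of (zip ts ks) t) w)"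
  proof (rule prod.mono_neutral_right)
    show "\<forall>t\<in>{..<N} - set ts. augmented Y t (map_of (zip ts ks) t) w = 1"
      by (auto simp: augmented_def split: option.split dest!: map_of_SomeD set_zip_leftD)
  qed (use sub in auto)
  also have "\<dots> = (\<Prod>l<r. augmented Y (ts ! l) (map_of (zip ts ks) (ts ! l)) w)"
    by (rule prod.reindex_bij_betw[symmetric]) (use dist len in \<open>auto intro: bij_betw_nth\<close>)
  also have "\<dots> = monomial Y r ks ts w"
    unfolding monomial_def
    by (intro prod.cong refl) (simp add: augmented_def map_of_zip_nth len dist)
  finally show ?thesis .
qed

lemma sets_coord_algebra:
  "sets (coord_algebra P I) =
     sigma_sets (space P) {(\<lambda>w. w i) -` A \<inter> space P |i A. i \<in> I}"
  unfolding coord_algebra_def generated_by_def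
  by (subst sets_measure_of) auto

lemma space_coord_algebra [simp]: "space (coord_algebra P I) = space P"
  by (simp add: coord_algebra_def generated_by_def space_measure_of_conv)

lemma coord_algebra_mono: "I \<subseteq> J \<Longrightarrow> sets (coord_algebra P I) \<subseteq> sets (coord_algebra P J)"
  unfolding sets_coord_algebra by (intro sigma_sets_subseteq) blast

text \<open>
  The sets that do not separate \<open>w\<close> from \<open>w'\<close> form a \<open>\<sigma>\<close>-algebra containing the generators.
\<close>

lemma coord_measurable_agree:
  fixes f :: "(nat \<Rightarrow> nat) \<Rightarrow> 'a::t1_space"
  assumes f: "f \<in> borel_measurable (coord_algebra P I)"
    and w: "w \<in> space P" "w' \<in> space P" and agree: "\<And>i. i \<in> I \<Longrightarrow> w i = w' i"
  shows "f w = f w'"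
proof -
  have sep: "w \<in> A \<longleftrightarrow> w' \<in> A" if "A \<in> sets (coord_algebra P I)" for A
    using that unfolding sets_coord_algebra
    by (induction rule: sigma_sets.induct) (use w agree in auto)
  have "f -` {f w} \<inter> space P \<in> sets (coord_algebra P I)"
    using measurable_sets[OF f, of "{f w}"] by simp
  from sep[OF this] show ?thesis using w by auto
qed

context obtuse_random_walk
begin

lemma space_P: "space P = (\<Pi>\<^sub>E i\<in>UNIV. {0..CARD('d)})"
  using sets_eq_imp_space_eq[OF sets_P] by (simp add: sequence_space_def space_PiM)

lemma subalgebra_coord: "subalgebra P (coord_algebra P I)"
proof -
  have "sets (coord_algebra P I) \<subseteq> sets P"
    unfolding sets_coord_algebra
  proof (rule sets.sigma_sets_subset, safe)
    fix i and A :: "nat set"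
    have "(\<lambda>w. w i) \<in> measurable (sequence_space TYPE('d)) (count_space {0..CARD('d)})"
      unfolding sequence_space_def by (rule measurable_component_singleton) simp
    hence "(\<lambda>w. w i) \<in> measurable P (count_space {0..CARD('d)})"
      by (subst measurable_cong_sets[OF sets_P refl])
    from measurable_sets[OF this, of "A \<inter> {0..CARD('d)}"]
    have "(\<lambda>w. w i) -` (A \<inter> {0..CARD('d)}) \<inter> space P \<in> sets P" by simp
    also have "(\<lambda>w. w i) -` (A \<inter> {0..CARD('d)}) \<inter> space P = (\<lambda>w. w i) -` A \<inter> space P"
      by (auto simp: space_P PiE_iff)
    finally show "(\<lambda>w. w i) -` A \<inter> space P \<in> sets P" .
  qed
  thus ?thesis by (simp add: subalgebra_def)
qed

text \<open>
  Only \<open>n\<close> coordinates with finitely many values each matter. In particular the adapted variables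
  below are bounded, which settles all questions of integrability for products of steps of the walk.
\<close>

lemma coord_measurable_imp_finite_range:
  fixes f :: "(nat \<Rightarrow> nat) \<Rightarrow> 'a::t1_space"
  assumes f: "f \<in> borel_measurable (coord_algebra P {..<n})"
  shows "finite (f ` space P)"
proof (rule finite_subset)
  let ?R = "(\<lambda>g i. if i < n then g i else 0) ` (\<Pi>\<^sub>E i\<in>{..<n}. {0..CARD('d)})"
  show "finite (f ` ?R)" by (intro finite_imageI finite_PiE) auto
  show "f ` space P \<subseteq> f ` ?R"
  proof safe
    fix w assume w: "w \<in> space P"
    let ?w = "\<lambda>i. if i < n then w i else 0"
    have "?w \<in> space P" using w by (auto simp: space_P PiE_iff)
    hence eq: "f w = f ?w" by (intro coord_measurable_agree[OF f w]) auto
    have "?w \<in> ?R"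
      by (rule image_eqI[of _ _ "restrict w {..<n}"]) (use w in \<open>auto simp: space_P PiE_iff\<close>)
    thus "f w \<in> f ` ?R" unfolding eq by (rule imageI)
  qed
qed

lemma coord_measurable_integrable:
  fixes f :: "(nat \<Rightarrow> nat) \<Rightarrow> real"
  assumes f: "f \<in> borel_measurable (coord_algebra P {..<n})"
  shows "integrable P f"
proof -
  have "bounded (f ` space P)"
    by (rule finite_imp_bounded[OF coord_measurable_imp_finite_range[OF f]])
  then obtain B where "\<And>w. w \<in> space P \<Longrightarrow> norm (f w) \<le> B"
    by (auto simp: bounded_iff)
  thus ?thesis
    by (intro integrable_const_bound[of _ B] AE_I2 measurable_from_subalg[OF subalgebra_coord f])
qed

lemma walk_measurable:
  assumes "t < n"
  shows "walk v t \<in> borel_measurable (coord_algebra P {..<n})"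
proof (rule measurableI)
  fix A :: "(real^'d) set" assume A: "A \<in> sets borel"
  have "walk v t -` A \<inter> space P \<in> sets (generated_by (space P) borel (walk v) {..t})"
    unfolding generated_by_def using A by (subst sets_measure_of) auto
  also have "\<dots> = sets (coord_algebra P {..t})" by (rule sigma_walk)
  also have "\<dots> \<subseteq> sets (coord_algebra P {..<n})"
    using assms by (intro coord_algebra_mono) auto
  finally show "walk v t -` A \<inter> space (coord_algebra P {..<n}) \<in> sets (coord_algebra P {..<n})"
    by simp
qed simp

lemma augmented_measurable:
  assumes "t < n"
  shows "augmented (walk v) t a \<in> borel_measurable (coord_algebra P {..<n})"
proof (cases a)
  case (Some k)
  have "(\<lambda>x::real^'d. x $ k) \<in> borel_measurable borel"
    by (intro borel_measurable_continuous_onI continuous_intros)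
  from measurable_compose[OF walk_measurable[OF assms] this]
  show ?thesis by (simp add: augmented_def[abs_def] Some)
qed (simp add: augmented_def[abs_def])

text \<open>
  Conditional orthonormality of the steps, tested against a variable that is known before time \<open>n\<close>.
\<close>

lemma integral_mult_augmented:
  assumes f: "f \<in> borel_measurable (coord_algebra P {..<n})"
  shows "(\<integral>w. f w * (augmented (walk v) n a w * augmented (walk v) n b w) \<partial>P)
    = (if a = b then \<integral>w. f w \<partial>P else 0)"
proof -
  let ?F = "coord_algebra P {..<n}" and ?g = "\<lambda>w. augmented (walk v) n a w * augmented (walk v) n b w"
  interpret finite_measure_subalgebra P ?F
    by unfold_locales (rule subalgebra_coord)
  have g': "?g \<in> borel_measurable (coord_algebra P {..<Suc n})"
    by (intro borel_measurable_times augmented_measurable) simp_all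
  have f': "f \<in> borel_measurable (coord_algebra P {..<Suc n})"
    by (rule measurable_from_subalg[OF _ f]) (simp add: subalgebra_def coord_algebra_mono)
  have g: "?g \<in> borel_measurable P"
    by (rule measurable_from_subalg[OF subalgebra_coord g'])
  have int: "integrable P (\<lambda>w. f w * ?g w)"
    by (rule coord_measurable_integrable[OF borel_measurable_times[OF f' g']])
  have "AE w in P. real_cond_exp P ?F ?g w = (if a = b then 1 else 0)"
  proof (cases a; cases b)
    assume "a = None" "b = None"
    moreover have "AE w in P. real_cond_exp P ?F (\<lambda>_. 1) w = 1"
      by (rule real_cond_exp_F_meas) auto
    ultimately show ?thesis by (simp add: augmented_def)
  next
    fix k l assume "a = Some k" "b = Some l"
    thus ?thesis using walk_normalized[of n k l] by (simp add: augmented_def)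
  qed (use walk_centered[of n] in \<open>simp_all add: augmented_def\<close>)
  hence "(\<integral>w. f w * real_cond_exp P ?F ?g w \<partial>P) = (\<integral>w. f w * (if a = b then 1 else 0) \<partial>P)"
    using measurable_from_subalg[OF subalgebra_coord f]
    by (intro integral_cong_AE borel_measurable_times) auto
  moreover have "(\<integral>w. f w * real_cond_exp P ?F ?g w \<partial>P) = (\<integral>w. f w * ?g w \<partial>P)"
    by (rule real_cond_exp_intg(2)[OF int f g])
  ultimately show ?thesis by simp
qed

lemma prod_augmented_measurable:
  "(\<lambda>w. \<Prod>t<N. augmented (walk v) t (\<alpha> t) w) \<in> borel_measurable (coord_algebra P {..<N})"
  by (intro borel_measurable_prod augmented_measurable) simp

lemma integral_prod_augmented:
  "(\<integral>w. (\<Prod>t<N. augmented (walk v) t (\<alpha> t) w) * (\<Prod>t<N. augmented (walk v) t (\<alpha>' t) w) \<partial>P)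
    = (if \<forall>t<N. \<alpha> t = \<alpha>' t then 1 else 0)"
proof (induction N)
  case 0
  show ?case by (simp add: prob_space)
next
  case (Suc N)
  let ?p = "\<lambda>\<alpha> w. \<Prod>t<N. augmented (walk v) t (\<alpha> t) w"
  have "(\<integral>w. (\<Prod>t<Suc N. augmented (walk v) t (\<alpha> t) w) * (\<Prod>t<Suc N. augmented (walk v) t (\<alpha>' t) w) \<partial>P)
      = (\<integral>w. (?p \<alpha> w * ?p \<alpha>' w) * (augmented (walk v) N (\<alpha> N) w * augmented (walk v) N (\<alpha>' N) w) \<partial>P)"
    by (simp only: prod.lessThan_Suc mult_ac)
  also have "\<dots> = (if \<alpha> N = \<alpha>' N then \<integral>w. ?p \<alpha> w * ?p \<alpha>' w \<partial>P else 0)"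
    by (rule integral_mult_augmented[OF borel_measurable_times[OF
          prod_augmented_measurable prod_augmented_measurable]])
  also have "\<dots> = (if \<forall>t<Suc N. \<alpha> t = \<alpha>' t then 1 else 0)"
    by (simp only: Suc.IH) (simp add: All_less_Suc)
  finally show ?case .
qed

lemma monomial_L2: "monomial (walk v) r ks ts \<in> L2 P"
proof -
  define N where "N = Suc (Max ((!) ts ` {..<r}))"
  have N: "ts ! l < N" if "l < r" for l
    using that by (simp add: N_def less_Suc_eq_le)
  have m: "(\<lambda>w. walk v (ts ! l) w $ (ks ! l)) \<in> borel_measurable (coord_algebra P {..<N})"
    if "l < r" for l
    using augmented_measurable[OF N[OF that], of "Some (ks ! l)"] by (simp add: augmented_def[abs_def])
  have m: "monomial (walk v) r ks ts \<in> borel_measurable (coord_algebra P {..<N})"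
    unfolding monomial_def[abs_def] by (intro borel_measurable_prod m) auto
  hence "integrable P (\<lambda>w. (monomial (walk v) r ks ts w)\<^sup>2)"
    by (intro coord_measurable_integrable[of _ N] borel_measurable_power)
  with measurable_from_subalg[OF subalgebra_coord m] show ?thesis
    by (simp add: L2_real_iff)
qed

text \<open>
  Gram matrix of the monomials. Read as finite maps from times to components, \<open>zip ts ks\<close> and
  \<open>zip ts' ks'\<close> must agree at every time; for distinct times this means that one index is a permutation
  of the other.
\<close>

lemma integral_monomial_mult:
  assumes "length ks = r" "length ts = r" "length ks' = s" "length ts' = s" "distinct ts" "distinct ts'"
  shows "(\<integral>w. monomial (walk v) r ks ts w * monomial (walk v) s ks' ts' w \<partial>P)
    = (if mset (zip ts ks) = mset (zip ts' ks') then 1 else 0)"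
proof -
  define N where "N = Suc (Max (set ts \<union> set ts'))"
  have "set ts \<subseteq> {..<N}" "set ts' \<subseteq> {..<N}" by (auto simp: N_def less_Suc_eq_le)
  note eq = prod_augmented_eq_monomial[OF assms(1,2,5) this(1), of "walk v"]
    prod_augmented_eq_monomial[OF assms(3,4,6) this(2), of "walk v"]
  let ?\<alpha> = "map_of (zip ts ks)" and ?\<alpha>' = "map_of (zip ts' ks')"
  have "(\<forall>t<N. ?\<alpha> t = ?\<alpha>' t) \<longleftrightarrow> ?\<alpha> = ?\<alpha>'"
  proof safe
    assume *: "\<forall>t<N. ?\<alpha> t = ?\<alpha>' t"
    show "?\<alpha> = ?\<alpha>'"
    proof
      fix t show "?\<alpha> t = ?\<alpha>' t"
      proof (cases "t < N")
        case False
        hence "t \<notin> set ts" "t \<notin> set ts'"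
          using \<open>set ts \<subseteq> {..<N}\<close> \<open>set ts' \<subseteq> {..<N}\<close> by auto
        hence "?\<alpha> t = None" "?\<alpha>' t = None" using assms by (simp_all add: map_of_zip_is_None)
        thus ?thesis by simp
      qed (use * in auto)
    qed
  qed auto
  also have "\<dots> \<longleftrightarrow> set (zip ts ks) = set (zip ts' ks')"
    by (rule map_of_inject_set) (use assms in simp_all)
  also have "\<dots> \<longleftrightarrow> mset (zip ts ks) = mset (zip ts' ks')"
    by (rule set_eq_iff_mset_eq_distinct) (use assms in \<open>auto intro: distinct_zipI1\<close>)
  finally show ?thesis
    using integral_prod_augmented[where N = N and \<alpha> = ?\<alpha> and \<alpha>' = ?\<alpha>'] unfolding eq by simp
qed

end

section \<open>Permutations of indices\<close>

lemma finite_upper [simp]: "finite (upper r :: 'd::finite list set)"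
  unfolding upper_def using finite_lists_length_eq[of "UNIV :: 'd set" r] by simp

lemma permute_list_in_upper [simp]: "permute_list \<sigma> ks \<in> upper r \<longleftrightarrow> ks \<in> upper r"
  by (simp add: upper_def)

lemma permute_list_in_Delta: "\<sigma> permutes {..<r} \<Longrightarrow> ts \<in> Delta r \<Longrightarrow> permute_list \<sigma> ts \<in> Delta r"
  by (auto simp: Delta_def)

text \<open>
  Distinctness of the times makes the action of the permutations on the indices free, so that the
  indices with a given multiset of pairs correspond one-to-one to permutations.
\<close>

lemma bij_betw_permute_index:
  assumes ks: "ks \<in> upper r" and ts: "ts \<in> Delta r"
  shows "bij_betw (\<lambda>\<sigma>. (permute_list \<sigma> ks, permute_list \<sigma> ts)) {\<sigma>. \<sigma> permutes {..<r}}
    {x \<in> upper r \<times> Delta r. mset (zip (snd x) (fst x)) = mset (zip ts ks)}"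
proof (rule bij_betw_imageI)
  have len: "length ks = r" "length ts = r" "distinct ts"
    using ks ts by (auto simp: upper_def Delta_def)
  show "inj_on (\<lambda>\<sigma>. (permute_list \<sigma> ks, permute_list \<sigma> ts)) {\<sigma>. \<sigma> permutes {..<r}}"
  proof (rule inj_onI, simp)
    fix \<sigma> \<tau> assume perm: "\<sigma> permutes {..<r}" "\<tau> permutes {..<r}"
      and eq: "permute_list \<sigma> ks = permute_list \<tau> ks \<and> permute_list \<sigma> ts = permute_list \<tau> ts"
    show "\<sigma> = \<tau>"
    proof
      fix i show "\<sigma> i = \<tau> i"
      proof (cases "i < r")
        case True
        have "ts ! \<sigma> i = ts ! \<tau> i"
          using eq True perm len permute_list_nth[of \<sigma> ts i] permute_list_nth[of \<tau> ts i] by simp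
        moreover have "\<sigma> i < r" "\<tau> i < r"
          using True permutes_in_image[OF perm(1), of i] permutes_in_image[OF perm(2), of i] by auto
        ultimately show ?thesis using len by (simp add: nth_eq_iff_index_eq)
      qed (use perm in \<open>auto simp: permutes_def\<close>)
    qed
  qed
  show "(\<lambda>\<sigma>. (permute_list \<sigma> ks, permute_list \<sigma> ts)) ` {\<sigma>. \<sigma> permutes {..<r}}
    = {x \<in> upper r \<times> Delta r. mset (zip (snd x) (fst x)) = mset (zip ts ks)}" (is "?L = ?R")
  proof (intro equalityI subsetI)
    fix x assume "x \<in> ?L"
    then obtain \<sigma> where \<sigma>: "\<sigma> permutes {..<r}" "x = (permute_list \<sigma> ks, permute_list \<sigma> ts)" by auto
    have "zip (permute_list \<sigma> ts) (permute_list \<sigma> ks) = permute_list \<sigma> (zip ts ks)"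
      using \<sigma> len by (intro permute_list_zip[symmetric]) auto
    thus "x \<in> ?R" using \<sigma> ks ts len by (auto simp: permute_list_in_Delta)
  next
    fix x assume x: "x \<in> ?R"
    obtain ks' ts' where x': "x = (ks', ts')" by (cases x)
    have len': "length ks' = r" "length ts' = r" using x x' by (auto simp: upper_def Delta_def)
    have "mset (zip ts' ks') = mset (zip ts ks)" using x x' by simp
    then obtain \<sigma> where \<sigma>: "\<sigma> permutes {..<length (zip ts ks)}" "permute_list \<sigma> (zip ts ks) = zip ts' ks'"
      by (rule mset_eq_permutation)
    hence "zip (permute_list \<sigma> ts) (permute_list \<sigma> ks) = zip ts' ks'"
      using len by (subst permute_list_zip[symmetric]) auto
    hence "permute_list \<sigma> ts = ts'" "permute_list \<sigma> ks = ks'"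
      using len len' by (metis length_permute_list map_fst_zip, metis length_permute_list map_snd_zip)
    thus "x \<in> ?L" using \<sigma> len x' by auto
  qed
qed

lemma sum_permute_class:
  assumes "ks \<in> upper r" and "ts \<in> Delta r"
  shows "(\<Sum>x\<in>{x \<in> upper r \<times> Delta r. mset (zip (snd x) (fst x)) = mset (zip ts ks)}. g (fst x) (snd x))
    = fact r * symmetrize r g ks ts"
  by (subst sum.reindex_bij_betw[OF bij_betw_permute_index[OF assms], symmetric])
     (simp add: symmetrize_def)

lemma card_permute_class:
  assumes "ks \<in> upper r" and "ts \<in> Delta r"
  shows "card {x \<in> upper r \<times> Delta r. mset (zip (snd x) (fst x)) = mset (zip ts ks)} = fact r"
    and "finite {x \<in> upper r \<times> Delta r. mset (zip (snd x) (fst x)) = mset (zip ts ks)}"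
  using bij_betw_same_card[OF bij_betw_permute_index[OF assms]] card_permutations[of "{..<r}" r]
    bij_betw_finite[OF bij_betw_permute_index[OF assms]] finite_permutations[of "{..<r}"]
  by auto

lemma symmetrize_symmetric_kernel:
  assumes "symmetric_kernel r f" "ks \<in> upper r" "ts \<in> Delta r"
  shows "symmetrize r f ks ts = f ks ts"
  using assms by (simp add: symmetrize_def symmetric_in_def card_permutations[of "{..<r}" r])

lemma has_sum_sum_finite:
  fixes f :: "'i \<Rightarrow> 'a \<Rightarrow> real"
  assumes "\<And>i. i \<in> I \<Longrightarrow> (f i has_sum S i) A"
  shows "((\<lambda>x. \<Sum>i\<in>I. f i x) has_sum (\<Sum>i\<in>I. S i)) A"
  using assms by (induction I rule: infinite_finite_induct) (auto intro: has_sum_add)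

text \<open>
  Symmetrization is an average of rearrangements of the kernel, each of which has the same square sum.
\<close>

lemma square_summable_symmetrize:
  assumes f: "square_summable r f"
  shows "square_summable r (symmetrize r f)"
proof -
  let ?S = "{\<sigma>. \<sigma> permutes {..<r}}" and ?h = "\<lambda>ts. \<Sum>ks\<in>upper r. (f ks ts)\<^sup>2"
  have fin: "finite ?S" by (rule finite_permutations) simp
  have card: "card ?S = fact r" by (rule card_permutations) auto
  have bij_upper: "bij_betw (permute_list \<sigma>) (upper r) (upper r :: 'a list set)"
    if "\<sigma> permutes {..<r}" for \<sigma>
    using that
    by (intro bij_betw_byWitness[where f' = "permute_list (inv \<sigma>)"])
       (auto simp: upper_def permutes_inv permutes_inv_o simp flip: permute_list_compose)
  have bij_Delta: "bij_betw (permute_list \<sigma>) (Delta r) (Delta r)" if "\<sigma> permutes {..<r}" for \<sigma>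
    using that
    by (intro bij_betw_byWitness[where f' = "permute_list (inv \<sigma>)"])
       (auto simp: Delta_def permutes_inv permutes_inv_o simp flip: permute_list_compose)
  have "((\<lambda>ts. \<Sum>\<sigma>\<in>?S. ?h (permute_list \<sigma> ts)) has_sum
      (\<Sum>\<sigma>\<in>?S. infsum (\<lambda>ts. ?h (permute_list \<sigma> ts)) (Delta r))) (Delta r)"
  proof (rule has_sum_sum_finite)
    fix \<sigma> assume "\<sigma> \<in> ?S"
    hence "bij_betw (permute_list \<sigma>) (Delta r) (Delta r)" by (simp add: bij_Delta)
    from summable_on_reindex_bij_betw[OF this, of ?h]
    show "((\<lambda>ts. ?h (permute_list \<sigma> ts)) has_sum infsum (\<lambda>ts. ?h (permute_list \<sigma> ts)) (Delta r)) (Delta r)"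
      using f by (simp add: square_summable_def)
  qed
  hence summ: "(\<lambda>ts. \<Sum>\<sigma>\<in>?S. ?h (permute_list \<sigma> ts)) summable_on Delta r"
    by (auto simp: summable_on_def)
  show ?thesis
    unfolding square_summable_def
  proof (rule summable_on_comparison_test[OF summ])
    fix ts assume "ts \<in> Delta r"
    have "(\<Sum>ks\<in>upper r. (symmetrize r f ks ts)\<^sup>2)
        \<le> (\<Sum>ks\<in>upper r. \<Sum>\<sigma>\<in>?S. (f (permute_list \<sigma> ks) (permute_list \<sigma> ts))\<^sup>2)"
    proof (rule sum_mono)
      fix ks :: "'a list"
      let ?a = "\<lambda>\<sigma>. f (permute_list \<sigma> ks) (permute_list \<sigma> ts)"
      have "(symmetrize r f ks ts)\<^sup>2 = (\<Sum>\<sigma>\<in>?S. ?a \<sigma>)\<^sup>2 / (fact r)\<^sup>2"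
        by (simp add: symmetrize_def power_divide)
      also have "\<dots> \<le> (fact r * (\<Sum>\<sigma>\<in>?S. (?a \<sigma>)\<^sup>2)) / (fact r)\<^sup>2"
        using sum_squared_le_sum_of_squares[of ?a ?S] card
        by (intro divide_right_mono) (simp_all add: mult.commute)
      also have "\<dots> = (\<Sum>\<sigma>\<in>?S. (?a \<sigma>)\<^sup>2) / fact r" by (simp add: power2_eq_square)
      also have "\<dots> \<le> (\<Sum>\<sigma>\<in>?S. (?a \<sigma>)\<^sup>2) / 1"
        by (intro divide_left_mono sum_nonneg) (auto simp: fact_ge_1)
      finally show "(symmetrize r f ks ts)\<^sup>2 \<le> (\<Sum>\<sigma>\<in>?S. (?a \<sigma>)\<^sup>2)" by simp
    qed
    also have "\<dots> = (\<Sum>\<sigma>\<in>?S. \<Sum>ks\<in>upper r. (f (permute_list \<sigma> ks) (permute_list \<sigma> ts))\<^sup>2)"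
      by (rule sum.swap)
    also have "\<dots> = (\<Sum>\<sigma>\<in>?S. ?h (permute_list \<sigma> ts))"
    proof (rule sum.cong[OF refl])
      fix \<sigma> assume "\<sigma> \<in> ?S"
      hence "bij_betw (permute_list \<sigma>) (upper r) (upper r :: 'a list set)" by (simp add: bij_upper)
      from sum.reindex_bij_betw[OF this, of "\<lambda>ks. (f ks (permute_list \<sigma> ts))\<^sup>2"]
      show "(\<Sum>ks\<in>upper r. (f (permute_list \<sigma> ks) (permute_list \<sigma> ts))\<^sup>2) = ?h (permute_list \<sigma> ts)" .
    qed
    finally show "(\<Sum>ks\<in>upper r. (symmetrize r f ks ts)\<^sup>2) \<le> (\<Sum>\<sigma>\<in>?S. ?h (permute_list \<sigma> ts))" .
  qed (auto intro: sum_nonneg)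
qed

section \<open>Existence of the multiple integrals and the isometry\<close>

lemma partial_integral_eq_monomials:
  "partial_integral Y r f A w = (\<Sum>ks\<in>upper r. \<Sum>ts\<in>A. f ks ts * monomial Y r ks ts w)"
  by (simp add: partial_integral_def monomial_def)

lemma partial_integral_eq_sum_pairs:
  "partial_integral Y r f A = (\<lambda>w. \<Sum>x\<in>upper r \<times> A. f (fst x) (snd x) * monomial Y r (fst x) (snd x) w)"
  by (auto simp: partial_integral_eq_monomials sum.cartesian_product split_def)

lemma partial_integral_diff:
  assumes "finite A" "finite B"
  shows "partial_integral Y r f A w - partial_integral Y r f B w
    = partial_integral Y r f (A - B) w - partial_integral Y r f (B - A) w"
proof -
  have eq: "partial_integral Y r f C w = partial_integral Y r f (C - D) w + partial_integral Y r f (C \<inter> D) w"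
    if "finite C" for C D
    unfolding partial_integral_def sum.distrib[symmetric]
    by (intro sum.cong refl trans[OF sum.Int_Diff[OF that] add.commute])
  show ?thesis using eq[OF assms(1), of B] eq[OF assms(2), of A] by (simp add: Int_commute)
qed

text \<open>
  The Cauchy criterion for unconditional sums.
\<close>

lemma summable_on_small_tail:
  fixes h :: "'i \<Rightarrow> real"
  assumes h: "h summable_on A" and e: "e > 0"
  obtains F where "finite F" "F \<subseteq> A" "\<And>B. finite B \<Longrightarrow> B \<subseteq> A - F \<Longrightarrow> sum h B \<le> e"
proof -
  obtain S where "(h has_sum S) A" using h by (auto simp: summable_on_def)
  hence "\<forall>\<^sub>F X in finite_subsets_at_top A. dist (sum h X) S < e / 2"
    unfolding has_sum_def using e by (intro tendstoD) auto
  then obtain F where F: "finite F" "F \<subseteq> A"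
    "\<And>X. finite X \<Longrightarrow> F \<subseteq> X \<Longrightarrow> X \<subseteq> A \<Longrightarrow> dist (sum h X) S < e / 2"
    by (auto simp: eventually_finite_subsets_at_top)
  show thesis
  proof (rule that[OF F(1,2)])
    fix B assume B: "finite B" "B \<subseteq> A - F"
    have "sum h (F \<union> B) = sum h F + sum h B" using F B by (intro sum.union_disjoint) auto
    moreover have "dist (sum h (F \<union> B)) S < e / 2" "dist (sum h F) S < e / 2"
      by (rule F(3); use F B in auto)+
    ultimately show "sum h B \<le> e" unfolding dist_real_def by linarith
  qed
qed

context obtuse_random_walk
begin

lemma partial_integral_L2: "partial_integral (walk v) r f A \<in> L2 P"
  unfolding partial_integral_eq_sum_pairs by (intro L2_sum L2_cmult monomial_L2)

lemma integral_partial_mult_monomial: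
  assumes ks: "ks \<in> upper r" and ts: "ts \<in> Delta r" and B: "B \<subseteq> Delta s"
  shows "(\<integral>w. partial_integral (walk v) s g B w * monomial (walk v) r ks ts w \<partial>P)
    = (\<Sum>x\<in>upper s \<times> B. if mset (zip (snd x) (fst x)) = mset (zip ts ks) then g (fst x) (snd x) else 0)"
proof -
  have "(\<integral>w. partial_integral (walk v) s g B w * monomial (walk v) r ks ts w \<partial>P)
    = (\<integral>w. (\<Sum>x\<in>upper s \<times> B. g (fst x) (snd x) *
        (monomial (walk v) s (fst x) (snd x) w * monomial (walk v) r ks ts w)) \<partial>P)"
    by (simp add: partial_integral_eq_sum_pairs sum_distrib_right mult.assoc)
  also have "\<dots> = (\<Sum>x\<in>upper s \<times> B. g (fst x) (snd x) *
      (\<integral>w. monomial (walk v) s (fst x) (snd x) w * monomial (walk v) r ks ts w \<partial>P))"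
    by (subst Bochner_Integration.integral_sum)
       (auto intro!: L2_mult_integrable monomial_L2 integrable_mult_right)
  also have "\<dots> = (\<Sum>x\<in>upper s \<times> B. if mset (zip (snd x) (fst x)) = mset (zip ts ks) then g (fst x) (snd x) else 0)"
  proof (rule sum.cong[OF refl])
    fix x :: "'d list \<times> nat list" assume "x \<in> upper s \<times> B"
    hence "fst x \<in> upper s" "snd x \<in> Delta s" using B by auto
    thus "g (fst x) (snd x) * (\<integral>w. monomial (walk v) s (fst x) (snd x) w * monomial (walk v) r ks ts w \<partial>P)
      = (if mset (zip (snd x) (fst x)) = mset (zip ts ks) then g (fst x) (snd x) else 0)"
      using ks ts by (subst integral_monomial_mult) (auto simp: upper_def Delta_def)
  qed
  finally show ?thesis .
qed

text \<open>
  Each monomial is shared by at most \<open>r!\<close> indices. This bound is what makes the partial sums of a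
  square summable kernel a Cauchy net.
\<close>

lemma integral_partial_square_le:
  assumes A: "finite A" "A \<subseteq> Delta r"
  shows "(\<integral>w. (partial_integral (walk v) r f A w)\<^sup>2 \<partial>P)
    \<le> fact r * (\<Sum>ts\<in>A. \<Sum>ks\<in>upper r. (f ks ts)\<^sup>2)"
proof -
  let ?X = "(upper r :: 'd list set) \<times> A" and ?c = "\<lambda>x. f (fst x) (snd x)"
  define q :: "'d list \<times> nat list \<Rightarrow> 'd list \<times> nat list \<Rightarrow> real"
    where "q x y = (if mset (zip (snd y) (fst y)) = mset (zip (snd x) (fst x)) then 1 else 0)" for x y
  have fin: "finite ?X" using A by simp
  have X: "fst x \<in> upper r" "snd x \<in> Delta r" if "x \<in> ?X" for x using that A by auto
  have row_sum: "(\<Sum>y\<in>?X. q x y) \<le> fact r" if x: "x \<in> ?X" for x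
  proof -
    let ?C = "{y \<in> upper r \<times> Delta r. mset (zip (snd y) (fst y)) = mset (zip (snd x) (fst x))}"
    have "(\<Sum>y\<in>?X. q x y) = real (card {y \<in> ?X. mset (zip (snd y) (fst y)) = mset (zip (snd x) (fst x))})"
      using sum.inter_filter[OF fin, of "\<lambda>_. 1::real", symmetric] by (simp add: q_def)
    also have "card {y \<in> ?X. mset (zip (snd y) (fst y)) = mset (zip (snd x) (fst x))} \<le> card ?C"
      using A by (intro card_mono card_permute_class(2)[OF X[OF x]]) auto
    also have "card ?C = fact r" by (rule card_permute_class(1)[OF X[OF x]])
    finally show ?thesis by simp
  qed
  have "(\<integral>w. (partial_integral (walk v) r f A w)\<^sup>2 \<partial>P)
    = (\<integral>w. (\<Sum>x\<in>?X. ?c x * (partial_integral (walk v) r f A w * monomial (walk v) r (fst x) (snd x) w)) \<partial>P)"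
    unfolding power2_eq_square
    by (subst (2) partial_integral_eq_sum_pairs) (simp add: sum_distrib_left mult_ac)
  also have "\<dots> = (\<Sum>x\<in>?X. ?c x * (\<integral>w. partial_integral (walk v) r f A w * monomial (walk v) r (fst x) (snd x) w \<partial>P))"
    by (subst Bochner_Integration.integral_sum)
       (auto intro!: L2_mult_integrable partial_integral_L2 monomial_L2 integrable_mult_right)
  also have "\<dots> = (\<Sum>x\<in>?X. \<Sum>y\<in>?X. ?c x * ?c y * q x y)"
  proof (rule sum.cong[OF refl])
    fix x assume x: "x \<in> ?X"
    show "?c x * (\<integral>w. partial_integral (walk v) r f A w * monomial (walk v) r (fst x) (snd x) w \<partial>P)
      = (\<Sum>y\<in>?X. ?c x * ?c y * q x y)"
      unfolding integral_partial_mult_monomial[OF X[OF x] A(2)] sum_distrib_left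
      by (intro sum.cong refl) (simp add: q_def)
  qed
  \<comment> \<open>Since the Gram matrix \<open>q\<close> is nonnegative and symmetric, its quadratic form is at most the
    largest row sum times the squared length.\<close>
  also have "\<dots> \<le> (\<Sum>x\<in>?X. \<Sum>y\<in>?X. ((?c x)\<^sup>2 * q x y + (?c y)\<^sup>2 * q y x) / 2)"
  proof (intro sum_mono)
    fix x y
    have "0 \<le> (?c x - ?c y)\<^sup>2" by simp
    hence "?c x * ?c y \<le> ((?c x)\<^sup>2 + (?c y)\<^sup>2) / 2" by (simp add: power2_diff)
    hence "?c x * ?c y * q x y \<le> ((?c x)\<^sup>2 + (?c y)\<^sup>2) / 2 * q x y"
      by (intro mult_right_mono) (auto simp: q_def)
    moreover have "q y x = q x y" by (auto simp: q_def)
    ultimately show "?c x * ?c y * q x y \<le> ((?c x)\<^sup>2 * q x y + (?c y)\<^sup>2 * q y x) / 2"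
      by (simp add: algebra_simps)
  qed
  also have "\<dots> = (\<Sum>x\<in>?X. \<Sum>y\<in>?X. (?c x)\<^sup>2 * q x y)"
    using sum.swap[of "\<lambda>x y. (?c x)\<^sup>2 * q x y" ?X ?X]
    by (simp add: sum.distrib flip: sum_divide_distrib)
  also have "\<dots> = (\<Sum>x\<in>?X. (?c x)\<^sup>2 * (\<Sum>y\<in>?X. q x y))" by (simp add: sum_distrib_left)
  also have "\<dots> \<le> (\<Sum>x\<in>?X. (?c x)\<^sup>2 * fact r)"
    by (intro sum_mono mult_left_mono row_sum) auto
  also have "\<dots> = fact r * (\<Sum>ks\<in>upper r. \<Sum>ts\<in>A. (f ks ts)\<^sup>2)"
    by (simp add: sum.cartesian_product split_def sum_distrib_left mult.commute)
  also have "(\<Sum>ks\<in>upper r. \<Sum>ts\<in>A. (f ks ts)\<^sup>2) = (\<Sum>ts\<in>A. \<Sum>ks\<in>upper r. (f ks ts)\<^sup>2)"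
    by (rule sum.swap)
  finally show ?thesis .
qed

text \<open>
  The index set is countable, so the sequential completeness of \<open>L\<^sup>2\<close> gives a limit along an exhausting
  sequence of finite sets. The Cauchy property of the net transfers it to all finite sets.
\<close>

lemma partial_integrals_converge:
  assumes f: "square_summable r f"
  obtains Z where "Z \<in> L2 P"
    "((\<lambda>A. \<integral>w. (Z w - partial_integral (walk v) r f A w)\<^sup>2 \<partial>P) \<longlongrightarrow> 0) (finite_subsets_at_top (Delta r))"
proof -
  let ?h = "\<lambda>ts. \<Sum>ks\<in>upper r. (f ks ts)\<^sup>2" and ?p = "partial_integral (walk v) r f"
  have tail: "\<exists>F. finite F \<and> F \<subseteq> Delta r \<and> (\<forall>A B. finite A \<longrightarrow> finite B \<longrightarrow> F \<subseteq> A \<longrightarrow> F \<subseteq> B \<longrightarrow>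
      A \<subseteq> Delta r \<longrightarrow> B \<subseteq> Delta r \<longrightarrow> (\<integral>w. (?p A w - ?p B w)\<^sup>2 \<partial>P) \<le> e)" if e: "e > 0" for e
  proof -
    \<comment> \<open>One factor 2 comes from the triangle inequality, another from the two differences
      \<open>A - B\<close> and \<open>B - A\<close>.\<close>
    have "e / (4 * fact r) > 0" using e by simp
    with f obtain F where F: "finite F" "F \<subseteq> Delta r"
      "\<And>B. finite B \<Longrightarrow> B \<subseteq> Delta r - F \<Longrightarrow> sum ?h B \<le> e / (4 * fact r)"
      unfolding square_summable_def by (rule summable_on_small_tail) blast
    have le: "(\<integral>w. (?p A w)\<^sup>2 \<partial>P) \<le> e / 4" if A: "finite A" "A \<subseteq> Delta r - F" for A
    proof -
      have "(\<integral>w. (?p A w)\<^sup>2 \<partial>P) \<le> fact r * sum ?h A"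
        using A by (intro integral_partial_square_le) auto
      also have "\<dots> \<le> fact r * (e / (4 * fact r))"
        by (intro mult_left_mono F A) auto
      finally show ?thesis by simp
    qed
    show ?thesis
    proof (intro exI[of _ F] conjI allI impI F)
      fix A B assume AB: "finite A" "finite B" "F \<subseteq> A" "F \<subseteq> B" "A \<subseteq> Delta r" "B \<subseteq> Delta r"
      have "(\<integral>w. (?p A w - ?p B w)\<^sup>2 \<partial>P) = (\<integral>w. (?p (A - B) w - ?p (B - A) w)\<^sup>2 \<partial>P)"
        by (subst partial_integral_diff) (use AB in auto)
      also have "\<dots> \<le> 2 * (\<integral>w. (?p (A - B) w)\<^sup>2 \<partial>P) + 2 * (\<integral>w. (?p (B - A) w)\<^sup>2 \<partial>P)"
        by (intro L2_integral_diff_square_le partial_integral_L2)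
      also have "\<dots> \<le> 2 * (e / 4) + 2 * (e / 4)"
        by (intro add_mono mult_left_mono le) (use AB in auto)
      finally show "(\<integral>w. (?p A w - ?p B w)\<^sup>2 \<partial>P) \<le> e" by simp
    qed
  qed
  define S where "S n = {ts \<in> Delta r. to_nat ts < n}" for n
  have S: "finite (S n)" "S n \<subseteq> Delta r" for n
  proof -
    have "finite (to_nat -` {..<n} :: nat list set)" by (intro finite_vimageI) auto
    thus "finite (S n)" by (rule finite_subset[rotated]) (auto simp: S_def)
  qed (auto simp: S_def)
  have S_exhaust: "\<exists>N. \<forall>n\<ge>N. F \<subseteq> S n" if F: "finite F" "F \<subseteq> Delta r" for F
  proof (intro exI[of _ "Suc (Max (to_nat ` F))"] allI impI subsetI)
    fix n ts assume n: "n \<ge> Suc (Max (to_nat ` F))" and ts: "ts \<in> F"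
    have "to_nat ts \<le> Max (to_nat ` F)" using F ts by simp
    hence "to_nat ts < n" using n by linarith
    thus "ts \<in> S n" using F ts by (auto simp: S_def)
  qed
  obtain Z where Z: "Z \<in> L2 P" "(\<lambda>n. \<integral>w. (Z w - ?p (S n) w)\<^sup>2 \<partial>P) \<longlonglongrightarrow> 0"
  proof (rule L2_complete[of "\<lambda>n. ?p (S n)"])
    show "?p (S n) \<in> L2 P" for n by (rule partial_integral_L2)
  next
    fix e :: real assume e: "e > 0"
    from tail[OF e] obtain F where F: "finite F" "F \<subseteq> Delta r"
      and F_bound: "\<forall>A B. finite A \<longrightarrow> finite B \<longrightarrow> F \<subseteq> A \<longrightarrow> F \<subseteq> B \<longrightarrow> A \<subseteq> Delta r \<longrightarrow> B \<subseteq> Delta r \<longrightarrow>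
        (\<integral>w. (?p A w - ?p B w)\<^sup>2 \<partial>P) \<le> e"
      by (elim exE conjE) (rule that)
    obtain N where N: "\<And>n. n \<ge> N \<Longrightarrow> F \<subseteq> S n" using S_exhaust[OF F] by blast
    show "\<exists>N. \<forall>m\<ge>N. \<forall>n\<ge>N. (\<integral>w. (?p (S m) w - ?p (S n) w)\<^sup>2 \<partial>P) \<le> e"
      by (intro exI[of _ N] allI impI F_bound[rule_format] S N)
  next
    fix Z assume "Z \<in> L2 P" "(\<lambda>n. \<integral>w. (Z w - ?p (S n) w)\<^sup>2 \<partial>P) \<longlonglongrightarrow> 0"
    thus thesis by (rule that)
  qed
  have "((\<lambda>A. \<integral>w. (Z w - ?p A w)\<^sup>2 \<partial>P) \<longlongrightarrow> 0) (finite_subsets_at_top (Delta r))"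
  proof (rule tendstoI)
    fix e :: real assume e: "e > 0"
    hence "e / 8 > 0" by simp
    from tail[OF this] obtain F where F: "finite F" "F \<subseteq> Delta r"
      and F_bound: "\<forall>A B. finite A \<longrightarrow> finite B \<longrightarrow> F \<subseteq> A \<longrightarrow> F \<subseteq> B \<longrightarrow> A \<subseteq> Delta r \<longrightarrow> B \<subseteq> Delta r \<longrightarrow>
        (\<integral>w. (?p A w - ?p B w)\<^sup>2 \<partial>P) \<le> e / 8"
      by (elim exE conjE) (rule that)
    obtain N where N: "\<And>n. n \<ge> N \<Longrightarrow> F \<subseteq> S n" using S_exhaust[OF F(1,2)] by blast
    have "\<forall>\<^sub>F n in sequentially. (\<integral>w. (Z w - ?p (S n) w)\<^sup>2 \<partial>P) < e / 8"
      using Z(2) \<open>e / 8 > 0\<close> by (rule order_tendstoD(2))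
    moreover have "\<forall>\<^sub>F n in sequentially. n \<ge> N" by (rule eventually_ge_at_top)
    ultimately have "\<forall>\<^sub>F n in sequentially. (\<integral>w. (Z w - ?p (S n) w)\<^sup>2 \<partial>P) < e / 8 \<and> n \<ge> N"
      by (rule eventually_conj)
    then obtain n where n: "(\<integral>w. (Z w - ?p (S n) w)\<^sup>2 \<partial>P) < e / 8" "F \<subseteq> S n"
      using N by (auto simp: eventually_sequentially)
    show "\<forall>\<^sub>F A in finite_subsets_at_top (Delta r). dist (\<integral>w. (Z w - ?p A w)\<^sup>2 \<partial>P) 0 < e"
      unfolding eventually_finite_subsets_at_top
    proof (intro exI[of _ F] conjI allI impI F)
      fix A assume A: "finite A \<and> F \<subseteq> A \<and> A \<subseteq> Delta r"
      have "(\<integral>w. (Z w - ?p A w)\<^sup>2 \<partial>P) = (\<integral>w. ((Z w - ?p (S n) w) - (?p A w - ?p (S n) w))\<^sup>2 \<partial>P)"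
        by simp
      also have "\<dots> \<le> 2 * (\<integral>w. (Z w - ?p (S n) w)\<^sup>2 \<partial>P) + 2 * (\<integral>w. (?p A w - ?p (S n) w)\<^sup>2 \<partial>P)"
        by (intro L2_integral_diff_square_le L2_diff Z partial_integral_L2)
      also have "\<dots> < e"
      proof -
        have "(\<integral>w. (?p A w - ?p (S n) w)\<^sup>2 \<partial>P) \<le> e / 8"
          using F_bound[rule_format, of A "S n"] A S[of n] n(2) by blast
        thus ?thesis using n(1) e by linarith
      qed
      finally show "dist (\<integral>w. (Z w - ?p A w)\<^sup>2 \<partial>P) 0 < e" by simp
    qed
  qed
  with Z(1) show thesis by (rule that)
qed

text \<open>
  In order 0 the integral is a constant by definition; it is also the sum over the single empty index,
  so that all orders share the same characterization.
\<close>

lemma multiple_integral_converges: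
  assumes f: "square_summable r f"
  shows multiple_integral_L2: "multiple_integral P (walk v) r f \<in> L2 P"
    and multiple_integral_limit: "((\<lambda>A. \<integral>w. (multiple_integral P (walk v) r f w - partial_integral (walk v) r f A w)\<^sup>2 \<partial>P)
      \<longlongrightarrow> 0) (finite_subsets_at_top (Delta r))"
proof -
  let ?Q = "\<lambda>Z. Z \<in> L2 P \<and>
    ((\<lambda>A. \<integral>w. (Z w - partial_integral (walk v) r f A w)\<^sup>2 \<partial>P) \<longlongrightarrow> 0) (finite_subsets_at_top (Delta r))"
  have "?Q (multiple_integral P (walk v) r f)"
  proof (cases "r = 0")
    case True
    have "Delta 0 = {[]}" "upper 0 = {[] :: 'd list}" by (auto simp: Delta_def upper_def)
    thus ?thesis
      by (simp add: True multiple_integral_def L2_real_iff finite_subsets_at_top_finite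
          partial_integral_def tendsto_principal_singleton[THEN tendsto_eq_rhs])
  next
    case False
    from f have "\<exists>Z. ?Q Z" by (rule partial_integrals_converge) blast
    hence "?Q (SOME Z. ?Q Z)" by (rule someI_ex)
    thus ?thesis using False by (simp add: multiple_integral_def)
  qed
  thus "multiple_integral P (walk v) r f \<in> L2 P"
    "((\<lambda>A. \<integral>w. (multiple_integral P (walk v) r f w - partial_integral (walk v) r f A w)\<^sup>2 \<partial>P)
      \<longlongrightarrow> 0) (finite_subsets_at_top (Delta r))"
    by auto
qed

text \<open>
  Once a finite set of times contains all rearrangements of \<open>ts\<close>, the pairing of the partial sum with
  the monomial no longer changes.
\<close>

lemma integral_multiple_mult_monomial:
  assumes g: "square_summable s g" and ks: "ks \<in> upper r" and ts: "ts \<in> Delta r"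
  shows "(\<integral>w. multiple_integral P (walk v) s g w * monomial (walk v) r ks ts w \<partial>P)
    = (if r = s then fact r * symmetrize r g ks ts else 0)"
proof -
  let ?m = "monomial (walk v) r ks ts"
  let ?C = "{x \<in> upper s \<times> Delta s. mset (zip (snd x) (fst x)) = mset (zip ts ks)}"
  have empty: "?C = {}" if "r \<noteq> s"
  proof -
    have "length (zip (snd x) (fst x)) = s" if "x \<in> ?C" for x
      using that by (auto simp: upper_def Delta_def)
    moreover have "length (zip ts ks) = r" using ks ts by (auto simp: upper_def Delta_def)
    ultimately show ?thesis using \<open>r \<noteq> s\<close> by (force dest: mset_eq_length)
  qed
  have fin: "finite ?C"
  proof (cases "r = s")
    case True
    thus ?thesis using card_permute_class(2)[OF ks ts] by simp
  next
    case False
    show ?thesis unfolding empty[OF False] by simp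
  qed
  have val: "(\<Sum>x\<in>?C. g (fst x) (snd x)) = (if r = s then fact r * symmetrize r g ks ts else 0)"
  proof (cases "r = s")
    case True
    thus ?thesis using sum_permute_class[OF ks ts, of g] by (simp only: simp_thms if_True)
  next
    case False
    thus ?thesis unfolding empty[OF False] by simp
  qed
  have "((\<lambda>B. \<integral>w. partial_integral (walk v) s g B w * ?m w \<partial>P)
      \<longlongrightarrow> (\<integral>w. multiple_integral P (walk v) s g w * ?m w \<partial>P)) (finite_subsets_at_top (Delta s))"
    by (intro tendsto_integral_mult_L2 multiple_integral_L2 multiple_integral_limit g monomial_L2
        partial_integral_L2)
  moreover have "\<forall>\<^sub>F B in finite_subsets_at_top (Delta s).
      (\<integral>w. partial_integral (walk v) s g B w * ?m w \<partial>P) = (\<Sum>x\<in>?C. g (fst x) (snd x))"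
    unfolding eventually_finite_subsets_at_top
  proof (intro exI[of _ "snd ` ?C"] conjI allI impI)
    fix B assume B: "finite B \<and> snd ` ?C \<subseteq> B \<and> B \<subseteq> Delta s"
    have "(\<integral>w. partial_integral (walk v) s g B w * ?m w \<partial>P)
      = (\<Sum>x\<in>upper s \<times> B. if mset (zip (snd x) (fst x)) = mset (zip ts ks) then g (fst x) (snd x) else 0)"
      using B by (intro integral_partial_mult_monomial ks ts) auto
    also have "\<dots> = (\<Sum>x\<in>{x \<in> upper s \<times> B. mset (zip (snd x) (fst x)) = mset (zip ts ks)}. g (fst x) (snd x))"
      using B by (intro sum.inter_filter[symmetric]) auto
    also have "{x \<in> upper s \<times> B. mset (zip (snd x) (fst x)) = mset (zip ts ks)} = ?C"
      using B by force
    finally show "(\<integral>w. partial_integral (walk v) s g B w * ?m w \<partial>P) = (\<Sum>x\<in>?C. g (fst x) (snd x))" .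
  next
    show "finite (snd ` ?C)" using fin by (rule finite_imageI)
    show "snd ` ?C \<subseteq> Delta s" by auto
  qed
  ultimately show ?thesis
    unfolding val[symmetric]
    by (rule tendsto_unique[OF finite_subsets_at_top_neq_bot _ tendsto_eventually])
qed

text \<open>
  Isometry for kernels without any symmetry. The series is not visibly symmetric in \<open>f\<close> and \<open>g\<close>
  while the integral is; \<open>integral_multiple_symmetrize\<close> exploits this.
\<close>

lemma integral_multiple_mult_has_sum:
  assumes f: "square_summable r f" and g: "square_summable s g"
  shows "((\<lambda>ts. \<Sum>ks\<in>upper r. f ks ts * (if r = s then fact r * symmetrize r g ks ts else 0))
    has_sum (\<integral>w. multiple_integral P (walk v) r f w * multiple_integral P (walk v) s g w \<partial>P)) (Delta r)"
proof -
  let ?I = "multiple_integral P (walk v) s g"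
  let ?t = "\<lambda>ts. \<Sum>ks\<in>upper r. f ks ts * (if r = s then fact r * symmetrize r g ks ts else 0)"
  have "((\<lambda>A. \<integral>w. partial_integral (walk v) r f A w * ?I w \<partial>P)
      \<longlongrightarrow> (\<integral>w. multiple_integral P (walk v) r f w * ?I w \<partial>P)) (finite_subsets_at_top (Delta r))"
    by (intro tendsto_integral_mult_L2 multiple_integral_L2 multiple_integral_limit f g
        partial_integral_L2)
  moreover have "\<forall>\<^sub>F A in finite_subsets_at_top (Delta r).
      (\<integral>w. partial_integral (walk v) r f A w * ?I w \<partial>P) = sum ?t A"
  proof (rule eventually_finite_subsets_at_top_weakI)
    fix A assume A: "finite A" "A \<subseteq> Delta r"
    have "(\<integral>w. partial_integral (walk v) r f A w * ?I w \<partial>P)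
      = (\<integral>w. (\<Sum>x\<in>upper r \<times> A. f (fst x) (snd x) * (monomial (walk v) r (fst x) (snd x) w * ?I w)) \<partial>P)"
      by (simp add: partial_integral_eq_sum_pairs sum_distrib_right mult.assoc)
    also have "\<dots> = (\<Sum>x\<in>upper r \<times> A. f (fst x) (snd x) *
        (\<integral>w. monomial (walk v) r (fst x) (snd x) w * ?I w \<partial>P))"
      by (subst Bochner_Integration.integral_sum)
         (auto intro!: L2_mult_integrable monomial_L2 multiple_integral_L2 g integrable_mult_right)
    also have "\<dots> = (\<Sum>x\<in>upper r \<times> A. f (fst x) (snd x) *
        (if r = s then fact r * symmetrize r g (fst x) (snd x) else 0))"
    proof (rule sum.cong[OF refl])
      fix x :: "'d list \<times> nat list" assume "x \<in> upper r \<times> A"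
      hence "fst x \<in> upper r" "snd x \<in> Delta r" using A by auto
      from integral_multiple_mult_monomial[OF g this]
      show "f (fst x) (snd x) * (\<integral>w. monomial (walk v) r (fst x) (snd x) w * ?I w \<partial>P)
        = f (fst x) (snd x) * (if r = s then fact r * symmetrize r g (fst x) (snd x) else 0)"
        by (simp only: mult.commute[of "monomial _ _ _ _ _"])
    qed
    also have "\<dots> = sum ?t A"
      by (subst sum.swap) (simp add: sum.cartesian_product split_def)
    finally show "(\<integral>w. partial_integral (walk v) r f A w * ?I w \<partial>P) = sum ?t A" .
  qed
  ultimately show ?thesis unfolding has_sum_def by (rule Lim_transform_eventually)
qed

end

section \<open>Slices of kernels\<close>

lemma sum_upper_Suc:
  "(\<Sum>ks\<in>upper (Suc s). F ks) = (\<Sum>j\<in>UNIV. \<Sum>ks\<in>upper s. F (ks @ [j :: 'd::finite]))"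
proof -
  have "bij_betw (\<lambda>(j :: 'd, ks). ks @ [j]) (UNIV \<times> upper s) (upper (Suc s))"
    by (rule bij_betw_byWitness[where f' = "\<lambda>ks. (last ks, butlast ks)"])
       (auto simp: upper_def length_Suc_conv_rev)
  from sum.reindex_bij_betw[OF this, of F] show ?thesis
    by (simp add: sum.cartesian_product split_def)
qed

lemma bij_betw_append_time:
  "bij_betw (\<lambda>(k, ts). ts @ [k]) (SIGMA k:UNIV. {ts \<in> Delta s. k \<notin> set ts}) (Delta (Suc s))"
  by (rule bij_betw_byWitness[where f' = "\<lambda>ts. (last ts, butlast ts)"])
     (auto simp: Delta_def length_Suc_conv_rev)

text \<open>
  A sum over \<open>Delta (Suc s)\<close> is computed by fixing the last time first. The zero terms
  account for the condition that the remaining times avoid \<open>k\<close>.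
\<close>

lemma has_sum_Delta_Suc:
  fixes H :: "nat list \<Rightarrow> real"
  assumes H: "(H has_sum B) (Delta (Suc s))"
    and b: "\<And>k. ((\<lambda>ts. if k \<in> set ts then 0 else H (ts @ [k])) has_sum b k) (Delta s)"
  shows "(b has_sum B) UNIV"
proof (rule has_sum_Sigma[OF isUCont_plus])
  show "((\<lambda>x. H (case x of (k, ts) \<Rightarrow> ts @ [k])) has_sum B) (SIGMA k:UNIV. {ts \<in> Delta s. k \<notin> set ts})"
    using has_sum_reindex_bij_betw[OF bij_betw_append_time[of s], of H B] H by simp
  fix k :: nat
  have "((\<lambda>ts. H (ts @ [k])) has_sum b k) {ts \<in> Delta s. k \<notin> set ts}
    \<longleftrightarrow> ((\<lambda>ts. if k \<in> set ts then 0 else H (ts @ [k])) has_sum b k) (Delta s)"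
    by (rule has_sum_cong_neutral) auto
  with b[of k] show "((\<lambda>ts. H (case (k, ts) of (k, ts) \<Rightarrow> ts @ [k])) has_sum b k) {ts \<in> Delta s. k \<notin> set ts}"
    by simp
qed

lemma summable_on_Delta_Suc_slice:
  fixes H :: "nat list \<Rightarrow> real"
  assumes H: "H summable_on Delta (Suc s)"
  shows "(\<lambda>ts. if k \<in> set ts then 0 else H (ts @ [k])) summable_on Delta s"
proof -
  let ?D = "{ts \<in> Delta s. k \<notin> set ts}"
  have "H summable_on (\<lambda>ts. ts @ [k]) ` ?D"
    by (rule summable_on_subset_banach[OF H]) (auto simp: Delta_def)
  hence "(\<lambda>ts. H (ts @ [k])) summable_on ?D"
    by (subst (asm) summable_on_reindex) (auto simp: inj_on_def o_def)
  also have "(\<lambda>ts. H (ts @ [k])) summable_on ?D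
    \<longleftrightarrow> (\<lambda>ts. if k \<in> set ts then 0 else H (ts @ [k])) summable_on Delta s"
    by (rule summable_on_cong_neutral) auto
  finally show ?thesis .
qed

lemma square_summable_slice:
  assumes f: "square_summable (Suc s) f"
  shows "square_summable s (slice f j k)"
  unfolding square_summable_def
proof (rule summable_on_comparison_test)
  show "(\<lambda>ts. if k \<in> set ts then 0 else \<Sum>ks\<in>upper (Suc s). (f ks (ts @ [k]))\<^sup>2) summable_on Delta s"
    using f by (intro summable_on_Delta_Suc_slice) (simp add: square_summable_def)
  fix ts
  have "(\<Sum>ks\<in>upper s. (f (ks @ [j]) (ts @ [k]))\<^sup>2) \<le> (\<Sum>ks\<in>upper (Suc s). (f ks (ts @ [k]))\<^sup>2)"
    unfolding sum_upper_Suc by (rule member_le_sum) (auto intro: sum_nonneg)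
  thus "(\<Sum>ks\<in>upper s. (slice f j k ks ts)\<^sup>2)
      \<le> (if k \<in> set ts then 0 else \<Sum>ks\<in>upper (Suc s). (f ks (ts @ [k]))\<^sup>2)"
    by (simp add: slice_def)
qed (auto intro: sum_nonneg)

lemma symmetric_in_mono:
  "symmetric_in r n f \<Longrightarrow> s \<le> r \<Longrightarrow> symmetric_in s n f"
  unfolding symmetric_in_def by (meson lessThan_subset_iff permutes_subset)

text \<open>
  A permutation of the first \<open>s\<close> positions fixes the appended last entry.
\<close>

lemma symmetric_kernel_slice:
  assumes f: "symmetric_in s (Suc s) f"
  shows "symmetric_kernel s (slice f j k)"
  unfolding symmetric_in_def
proof (intro ballI allI impI)
  fix ks :: "'a list" and ts \<sigma> assume ks: "ks \<in> upper s" and ts: "ts \<in> Delta s" and \<sigma>: "\<sigma> permutes {..<s}"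
  have len: "length ks = s" "length ts = s" using ks ts by (auto simp: upper_def Delta_def)
  have app: "permute_list \<sigma> (xs @ [x]) = permute_list \<sigma> xs @ [x]" if "length xs = s" for xs :: "'b list" and x
  proof -
    have "\<sigma> i < s" if "i < s" for i using permutes_in_image[OF \<sigma>, of i] that by simp
    moreover have "\<sigma> s = s" using \<sigma> by (simp add: permutes_def)
    ultimately show ?thesis using \<open>length xs = s\<close> by (simp add: permute_list_def nth_append)
  qed
  have "f (permute_list \<sigma> (ks @ [j])) (permute_list \<sigma> (ts @ [k])) = f (ks @ [j]) (ts @ [k])" if "k \<notin> set ts"
    using f \<sigma> ks ts that unfolding symmetric_in_def by (auto simp: upper_def Delta_def)
  thus "slice f j k (permute_list \<sigma> ks) (permute_list \<sigma> ts) = slice f j k ks ts"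
    using \<sigma> len app[of ks] app[of ts] by (simp add: slice_def)
qed

section \<open>Duality\<close>

context obtuse_random_walk
begin

lemma multiple_integral_orthogonal:
  assumes "square_summable r f" "square_summable s g" "r \<noteq> s"
  shows "(\<integral>w. multiple_integral P (walk v) r f w * multiple_integral P (walk v) s g w \<partial>P) = 0"
  using integral_multiple_mult_has_sum[OF assms(1,2)] \<open>r \<noteq> s\<close>
  by (auto intro: has_sum_unique has_sum_0)

lemma multiple_integral_isometry:
  assumes f: "square_summable r f" and g: "square_summable r g" and sym: "symmetric_kernel r g"
  shows "((\<lambda>ts. fact r * (\<Sum>ks\<in>upper r. f ks ts * g ks ts)) has_sum
    (\<integral>w. multiple_integral P (walk v) r f w * multiple_integral P (walk v) r g w \<partial>P)) (Delta r)"
proof -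
  have "(\<Sum>ks\<in>upper r. f ks ts * (if r = r then fact r * symmetrize r g ks ts else 0))
    = fact r * (\<Sum>ks\<in>upper r. f ks ts * g ks ts)" if "ts \<in> Delta r" for ts
    using that sym by (simp add: symmetrize_symmetric_kernel sum_distrib_left mult_ac)
  with integral_multiple_mult_has_sum[OF f g] show ?thesis
    by (simp cong: has_sum_cong)
qed

text \<open>
  The kernel \<open>g\<close> may be replaced by its symmetrization when paired with a symmetric \<open>f\<close>. No
  rearrangement of infinite sums is needed: both sides are the sum of the same series, obtained
  from the isometry with the roles of the two factors exchanged.
\<close>

lemma integral_multiple_symmetrize:
  assumes f: "square_summable r f" and g: "square_summable r g" and sym: "symmetric_kernel r f"
  shows "(\<integral>w. multiple_integral P (walk v) r f w * multiple_integral P (walk v) r (symmetrize r g) w \<partial>P)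
    = (\<integral>w. multiple_integral P (walk v) r f w * multiple_integral P (walk v) r g w \<partial>P)"
proof -
  let ?I = "multiple_integral P (walk v) r"
  have "((\<lambda>ts. fact r * (\<Sum>ks\<in>upper r. symmetrize r g ks ts * f ks ts)) has_sum
      (\<integral>w. ?I (symmetrize r g) w * ?I f w \<partial>P)) (Delta r)"
    by (rule multiple_integral_isometry[OF square_summable_symmetrize[OF g] f sym])
  moreover have "((\<lambda>ts. fact r * (\<Sum>ks\<in>upper r. symmetrize r g ks ts * f ks ts)) has_sum
      (\<integral>w. ?I f w * ?I g w \<partial>P)) (Delta r)"
    using integral_multiple_mult_has_sum[OF f g] by (simp add: sum_distrib_left mult_ac)
  ultimately have "(\<integral>w. ?I (symmetrize r g) w * ?I f w \<partial>P) = (\<integral>w. ?I f w * ?I g w \<partial>P)"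
    by (rule has_sum_unique)
  thus ?thesis by (simp only: mult.commute)
qed

text \<open>
  The slices have order \<open>s\<close>, so their isometry contributes \<open>s!\<close> for every fixed last index; summing
  over that index restores the full scalar product of the kernels.
\<close>

lemma slice_integrals_has_sum:
  assumes f: "square_summable (Suc s) f" and g: "square_summable (Suc s) g"
    and sym: "symmetric_in s (Suc s) g"
    and B: "((\<lambda>ts. \<Sum>ks\<in>upper (Suc s). f ks ts * g ks ts) has_sum B) (Delta (Suc s))"
  shows "((\<lambda>k. \<Sum>j\<in>UNIV. \<integral>w. multiple_integral P (walk v) s (slice f j k) w *
      multiple_integral P (walk v) s (slice g j k) w \<partial>P) has_sum fact s * B) UNIV"
proof (rule has_sum_Delta_Suc)
  let ?H = "\<lambda>ts. fact s * (\<Sum>ks\<in>upper (Suc s). f ks ts * g ks ts)"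
  show "(?H has_sum fact s * B) (Delta (Suc s))" by (intro has_sum_cmult_right B)
  fix k
  have "((\<lambda>ts. \<Sum>j\<in>UNIV. fact s * (\<Sum>ks\<in>upper s. slice f j k ks ts * slice g j k ks ts)) has_sum
    (\<Sum>j\<in>UNIV. \<integral>w. multiple_integral P (walk v) s (slice f j k) w *
      multiple_integral P (walk v) s (slice g j k) w \<partial>P)) (Delta s)"
    by (intro has_sum_sum_finite multiple_integral_isometry square_summable_slice f g
        symmetric_kernel_slice sym)
  also have "(\<lambda>ts. \<Sum>j\<in>UNIV. fact s * (\<Sum>ks\<in>upper s. slice f j k ks ts * slice g j k ks ts))
    = (\<lambda>ts. if k \<in> set ts then 0 else ?H (ts @ [k]))"
    by (auto simp: slice_def sum_upper_Suc sum_distrib_left)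
  finally show "((\<lambda>ts. if k \<in> set ts then 0 else ?H (ts @ [k])) has_sum
    (\<Sum>j\<in>UNIV. \<integral>w. multiple_integral P (walk v) s (slice f j k) w *
      multiple_integral P (walk v) s (slice g j k) w \<partial>P)) (Delta s)" .
qed

text \<open>
  The adjoint relation for a single pair of multiple integrals. The factor \<open>r + 1\<close> of the gradient
  turns the \<open>r!\<close> of the slices into the \<open>(r + 1)!\<close> of the isometry in order \<open>r + 1\<close>.
\<close>

lemma multiple_integral_duality:
  assumes f: "square_summable (Suc r) f" "symmetric_kernel (Suc r) f"
    and g: "square_summable (Suc s) g"
  shows "((\<lambda>k. \<Sum>j\<in>UNIV. real (Suc r) * (\<integral>w. multiple_integral P (walk v) r (slice f j k) w *
      multiple_integral P (walk v) s (slice g j k) w \<partial>P)) has_sum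
    (\<integral>w. multiple_integral P (walk v) (Suc r) f w *
      multiple_integral P (walk v) (Suc s) (symmetrize (Suc s) g) w \<partial>P)) UNIV"
proof (cases "r = s")
  case False
  thus ?thesis
    by (simp add: multiple_integral_orthogonal square_summable_slice square_summable_symmetrize f g)
next
  case True
  let ?E = "\<integral>w. multiple_integral P (walk v) (Suc s) g w * multiple_integral P (walk v) (Suc s) f w \<partial>P"
  have f': "square_summable (Suc s) f" "symmetric_kernel (Suc s) f" using f True by simp_all
  have "((\<lambda>ts. inverse (fact (Suc s)) * (fact (Suc s) * (\<Sum>ks\<in>upper (Suc s). g ks ts * f ks ts))) has_sum
      inverse (fact (Suc s)) * ?E) (Delta (Suc s))"
    by (intro has_sum_cmult_right multiple_integral_isometry g f')
  hence "((\<lambda>ts. \<Sum>ks\<in>upper (Suc s). g ks ts * f ks ts) has_sum ?E / fact (Suc s)) (Delta (Suc s))"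
    by (simp del: fact_Suc add: mult.assoc[symmetric] divide_inverse mult.commute)
  note sums = has_sum_cmult_right[OF slice_integrals_has_sum[OF g f'(1) symmetric_in_mono[OF f'(2)] this],
      of "real (Suc s)"]
  have "real (Suc s) * (fact s * (?E / fact (Suc s))) = ?E"
    by (simp add: fact_Suc del: of_nat_Suc)
  with sums have "((\<lambda>k. real (Suc s) * (\<Sum>j\<in>UNIV. \<integral>w. multiple_integral P (walk v) s (slice g j k) w *
      multiple_integral P (walk v) s (slice f j k) w \<partial>P)) has_sum ?E) UNIV"
    by (simp only:)
  thus ?thesis
    unfolding True integral_multiple_symmetrize[OF f'(1) g f'(2)]
    by (simp only: sum_distrib_left mult.commute)
qed

text \<open>
  The special case \<open>g = f\<close> of the slicing formula: the squared norms of the slices add up to a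
  multiple of the squared norm of the kernel.
\<close>

lemma summable_slice_norms:
  assumes f: "square_summable (Suc s) f" "symmetric_in s (Suc s) f"
  shows "summable (\<lambda>k. \<integral>w. (multiple_integral P (walk v) s (slice f j k) w)\<^sup>2 \<partial>P)"
proof -
  let ?a = "\<lambda>j k. \<integral>w. (multiple_integral P (walk v) s (slice f j k) w)\<^sup>2 \<partial>P"
  obtain B where "((\<lambda>ts. \<Sum>ks\<in>upper (Suc s). f ks ts * f ks ts) has_sum B) (Delta (Suc s))"
    using f by (auto simp: square_summable_def summable_on_def power2_eq_square)
  from slice_integrals_has_sum[OF f(1) f this]
  have "summable (\<lambda>k. \<Sum>j\<in>UNIV. ?a j k)"
    by (auto simp: power2_eq_square dest: has_sum_imp_sums sums_summable)
  thus ?thesis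
  proof (rule summable_comparison_test'[of _ 0])
    fix k
    have "?a j k \<le> (\<Sum>j\<in>UNIV. ?a j k)" by (rule member_le_sum) auto
    thus "norm (?a j k) \<le> (\<Sum>j\<in>UNIV. ?a j k)" by simp
  qed
qed

lemma summable_process_norms:
  assumes "finite R" and f: "\<And>r. r \<in> R \<Longrightarrow> square_summable (Suc r) (f r) \<and> symmetric_in r (Suc r) (f r)"
  shows "summable (\<lambda>k. \<integral>w. (\<Sum>r\<in>R. c r * multiple_integral P (walk v) r (slice (f r) j k) w)\<^sup>2 \<partial>P)"
proof (rule summable_comparison_test'[of _ 0])
  let ?I = "\<lambda>r k. multiple_integral P (walk v) r (slice (f r) j k)"
  show "summable (\<lambda>k. (\<Sum>r\<in>R. (c r)\<^sup>2 * (\<integral>w. (?I r k w)\<^sup>2 \<partial>P)) * real (card R))"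
    using f by (intro summable_mult2 summable_sum summable_mult summable_slice_norms) auto
  fix k
  have L2: "?I r k \<in> L2 P" if "r \<in> R" for r
    using f[OF that] by (intro multiple_integral_L2 square_summable_slice) simp
  have int: "integrable P (\<lambda>w. (?I r k w)\<^sup>2)" if "r \<in> R" for r
    using L2[OF that] by (simp add: L2_real_iff)
  have "(\<integral>w. (\<Sum>r\<in>R. c r * ?I r k w)\<^sup>2 \<partial>P) \<le> (\<integral>w. (\<Sum>r\<in>R. (c r)\<^sup>2 * (?I r k w)\<^sup>2) * real (card R) \<partial>P)"
  proof (rule integral_mono)
    show "integrable P (\<lambda>w. (\<Sum>r\<in>R. c r * ?I r k w)\<^sup>2)"
      using L2_sum[of R "\<lambda>r w. c r * ?I r k w" P] L2_cmult[OF L2] by (simp add: L2_real_iff)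
    show "(\<Sum>r\<in>R. c r * ?I r k w)\<^sup>2 \<le> (\<Sum>r\<in>R. (c r)\<^sup>2 * (?I r k w)\<^sup>2) * real (card R)" for w
      using sum_squared_le_sum_of_squares[of "\<lambda>r. c r * ?I r k w" R] by (simp add: power_mult_distrib)
  qed (use int in auto)
  also have "\<dots> = (\<Sum>r\<in>R. (c r)\<^sup>2 * (\<integral>w. (?I r k w)\<^sup>2 \<partial>P)) * real (card R)"
    using int by (simp add: Bochner_Integration.integral_sum)
  finally show "norm (\<integral>w. (\<Sum>r\<in>R. c r * ?I r k w)\<^sup>2 \<partial>P)
      \<le> (\<Sum>r\<in>R. (c r)\<^sup>2 * (\<integral>w. (?I r k w)\<^sup>2 \<partial>P)) * real (card R)"
    by simp
qed

lemma integral_sum_mult_sum: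
  fixes a :: "'i \<Rightarrow> _ \<Rightarrow> real" and b :: "'k \<Rightarrow> _ \<Rightarrow> real"
  assumes "\<And>i. i \<in> I \<Longrightarrow> a i \<in> L2 P" "\<And>k. k \<in> K \<Longrightarrow> b k \<in> L2 P"
  shows "(\<integral>w. (\<Sum>i\<in>I. a i w) * (\<Sum>k\<in>K. b k w) \<partial>P) = (\<Sum>i\<in>I. \<Sum>k\<in>K. \<integral>w. a i w * b k w \<partial>P)"
proof -
  have int: "integrable P (\<lambda>w. a i w * b k w)" if "i \<in> I" "k \<in> K" for i k
    using assms that by (intro L2_mult_integrable) auto
  have "(\<integral>w. (\<Sum>i\<in>I. a i w) * (\<Sum>k\<in>K. b k w) \<partial>P) = (\<integral>w. (\<Sum>i\<in>I. \<Sum>k\<in>K. a i w * b k w) \<partial>P)"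
    by (simp only: sum_product)
  also have "\<dots> = (\<Sum>i\<in>I. \<integral>w. (\<Sum>k\<in>K. a i w * b k w) \<partial>P)"
    using int by (intro Bochner_Integration.integral_sum Bochner_Integration.integrable_sum) auto
  also have "\<dots> = (\<Sum>i\<in>I. \<Sum>k\<in>K. \<integral>w. a i w * b k w \<partial>P)"
    using int by (intro sum.cong refl Bochner_Integration.integral_sum) auto
  finally show ?thesis .
qed

text \<open>
  The adjoint relation for arbitrary expansions of \<open>F\<close> and \<open>G\<close>. The constant term of \<open>F\<close> does not
  contribute to the gradient, and on the other side it is orthogonal to the divergence, which has no
  component of order 0.
\<close>

lemma expansion_duality:
  fixes F :: "(nat \<Rightarrow> nat) \<Rightarrow> real" and G :: "nat \<Rightarrow> (nat \<Rightarrow> nat) \<Rightarrow> real^'d"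
  assumes F: "F \<in> L2 P" and G: "\<And>k. G k \<in> borel_measurable P"
    and f: "chaos_expansion P (walk v) F n f" and g: "process_expansion P (walk v) G m g"
  defines "D \<equiv> \<lambda>k w. \<chi> j. \<Sum>r=1..n. real r * multiple_integral P (walk v) (r - 1) (slice (f r) j k) w"
    and "\<delta> \<equiv> \<lambda>w. \<Sum>r\<le>m. multiple_integral P (walk v) (Suc r) (symmetrize (Suc r) (g r)) w"
  shows "AE w in P. summable (\<lambda>k. D k w \<bullet> G k w)"
    and "integrable P (\<lambda>w. \<Sum>k. D k w \<bullet> G k w)"
    and "integrable P (\<lambda>w. F w * \<delta> w)"
    and "(\<integral>w. (\<Sum>k. D k w \<bullet> G k w) \<partial>P) = (\<integral>w. F w * \<delta> w \<partial>P)"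
proof -
  let ?I = "multiple_integral P (walk v)"
  have ff: "symmetric_kernel r (f r)" "square_summable r (f r)" if "r \<le> n" for r
    using f that by (auto simp: chaos_expansion_def)
  have F_eq: "AE w in P. F w = (\<Sum>r\<le>n. ?I r (f r) w)"
    using f by (simp add: chaos_expansion_def)
  have gg: "symmetric_in r (Suc r) (g r)" "square_summable (Suc r) (g r)" if "r \<le> m" for r
    using g that by (auto simp: process_expansion_def)
  have G_eq: "AE w in P. G k w = (\<chi> j. \<Sum>r\<le>m. ?I r (slice (g r) j k) w)" for k
    using g by (simp add: process_expansion_def)
  define d where "d j k w = (\<Sum>r<n. real (Suc r) * ?I r (slice (f (Suc r)) j k) w)" for j k w
  define h where "h j k w = (\<Sum>r\<le>m. ?I r (slice (g r) j k) w)" for j k w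
  \<comment> \<open>The index shift puts gradient and process in the same form, indexed by the order of the slices.\<close>
  have D_eq: "D k w $ j = d j k w" for k w j
    by (simp add: D_def d_def sum.atLeast1_atMost_eq)
  have d_L2: "d j k \<in> L2 P" for j k
    unfolding d_def by (intro L2_sum L2_cmult multiple_integral_L2 square_summable_slice ff) auto
  have h_L2: "h j k \<in> L2 P" for j k
    unfolding h_def by (intro L2_sum multiple_integral_L2 square_summable_slice gg) auto
  have T_eq: "AE w in P. D k w \<bullet> G k w = (\<Sum>j\<in>UNIV. d j k w * h j k w)" for k
    using G_eq[of k] by eventually_elim (simp add: inner_vec_def D_eq h_def)
  have T_meas: "(\<lambda>w. D k w \<bullet> G k w) \<in> borel_measurable P" for k
  proof -
    have "(\<lambda>x::real^'d. x $ j) \<in> borel_measurable borel" for j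
      by (intro borel_measurable_continuous_onI continuous_intros)
    from measurable_compose[OF G this] have "(\<lambda>w. G k w $ j) \<in> borel_measurable P" for j .
    thus ?thesis
      unfolding inner_vec_def D_eq
      by (simp add: borel_measurable_sum borel_measurable_times L2_measurable[OF d_L2])
  qed
  have dh_int: "integrable P (\<lambda>w. d j k w * h j k w)" for j k
    by (intro L2_mult_integrable d_L2 h_L2)
  have S_int: "integrable P (\<lambda>w. \<Sum>j\<in>UNIV. d j k w * h j k w)" for k
    by (intro Bochner_Integration.integrable_sum dh_int)
  have T_int: "integrable P (\<lambda>w. D k w \<bullet> G k w)" for k
    using S_int[of k] by (rule integrable_cong_AE_imp[OF _ T_meas]) (use T_eq[of k] in auto)
  have T_abs: "(\<integral>w. \<bar>D k w \<bullet> G k w\<bar> \<partial>P)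
      \<le> (\<Sum>j\<in>UNIV. (\<integral>w. (d j k w)\<^sup>2 \<partial>P) + (\<integral>w. (h j k w)\<^sup>2 \<partial>P))" for k
  proof -
    have sq: "integrable P (\<lambda>w. (d j k w)\<^sup>2)" "integrable P (\<lambda>w. (h j k w)\<^sup>2)" for j
      using d_L2 h_L2 by (auto simp: L2_real_iff)
    have "(\<integral>w. \<bar>D k w \<bullet> G k w\<bar> \<partial>P) \<le> (\<integral>w. (\<Sum>j\<in>UNIV. (d j k w)\<^sup>2 + (h j k w)\<^sup>2) \<partial>P)"
    proof (rule integral_mono_AE)
      show "AE w in P. \<bar>D k w \<bullet> G k w\<bar> \<le> (\<Sum>j\<in>UNIV. (d j k w)\<^sup>2 + (h j k w)\<^sup>2)"
        using T_eq[of k]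
      proof eventually_elim
        case (elim w)
        have ab: "\<bar>a * b\<bar> \<le> a\<^sup>2 + b\<^sup>2" for a b :: real
        proof -
          have "0 \<le> (\<bar>a\<bar> - \<bar>b\<bar>)\<^sup>2" by simp
          hence "2 * \<bar>a * b\<bar> \<le> a\<^sup>2 + b\<^sup>2" by (simp add: power2_diff abs_mult)
          thus ?thesis by simp
        qed
        show ?case unfolding elim by (rule order_trans[OF sum_abs]) (intro sum_mono ab)
      qed
    qed (use sq T_int[of k] in auto)
    also have "\<dots> = (\<Sum>j\<in>UNIV. (\<integral>w. (d j k w)\<^sup>2 \<partial>P) + (\<integral>w. (h j k w)\<^sup>2 \<partial>P))"
      using sq by (simp add: Bochner_Integration.integral_sum)
    finally show ?thesis .
  qed
  have T_summable: "summable (\<lambda>k. \<integral>w. \<bar>D k w \<bullet> G k w\<bar> \<partial>P)"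
  proof (rule summable_comparison_test'[of _ 0])
    have "summable (\<lambda>k. \<integral>w. (d j k w)\<^sup>2 \<partial>P)" for j
      unfolding d_def
      by (rule summable_process_norms) (use symmetric_in_mono[OF ff(1)] ff(2) in auto)
    moreover have "summable (\<lambda>k. \<integral>w. (h j k w)\<^sup>2 \<partial>P)" for j
      using summable_process_norms[of "{..m}" g "\<lambda>_. 1" j] gg by (simp add: h_def)
    ultimately show "summable (\<lambda>k. \<Sum>j\<in>UNIV. (\<integral>w. (d j k w)\<^sup>2 \<partial>P) + (\<integral>w. (h j k w)\<^sup>2 \<partial>P))"
      by (intro summable_sum summable_add)
  qed (use T_abs in auto)
  have AE_summable: "AE w in P. summable (\<lambda>k. norm (D k w \<bullet> G k w))"
    using AE_summable_of_summable_integral[OF T_int T_summable] by simp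
  have norm_summable: "summable (\<lambda>k. \<integral>w. norm (D k w \<bullet> G k w) \<partial>P)"
    using T_summable by simp
  show "AE w in P. summable (\<lambda>k. D k w \<bullet> G k w)"
    using AE_summable by eventually_elim (rule summable_norm_cancel)
  show "integrable P (\<lambda>w. \<Sum>k. D k w \<bullet> G k w)"
    by (rule integrable_suminf[OF T_int AE_summable norm_summable])
  have \<delta>_L2: "\<delta> \<in> L2 P"
    unfolding \<delta>_def by (intro L2_sum multiple_integral_L2 square_summable_symmetrize gg) auto
  show "integrable P (\<lambda>w. F w * \<delta> w)" by (rule L2_mult_integrable[OF F \<delta>_L2])

  have "(\<lambda>k. \<integral>w. D k w \<bullet> G k w \<partial>P) sums (\<integral>w. (\<Sum>k. D k w \<bullet> G k w) \<partial>P)"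
    by (rule sums_integral[OF T_int AE_summable norm_summable])
  moreover have "(\<lambda>k. \<integral>w. D k w \<bullet> G k w \<partial>P) sums (\<integral>w. F w * \<delta> w \<partial>P)"
  proof -
    have "(\<integral>w. D k w \<bullet> G k w \<partial>P) = (\<Sum>r<n. \<Sum>s\<le>m. \<Sum>j\<in>UNIV. real (Suc r) *
        (\<integral>w. ?I r (slice (f (Suc r)) j k) w * ?I s (slice (g s) j k) w \<partial>P))" for k
    proof -
      have "(\<integral>w. D k w \<bullet> G k w \<partial>P) = (\<integral>w. (\<Sum>j\<in>UNIV. d j k w * h j k w) \<partial>P)"
        using T_eq[of k] T_meas[of k] S_int[of k] by (intro integral_cong_AE) auto
      also have "\<dots> = (\<Sum>j\<in>UNIV. \<integral>w. d j k w * h j k w \<partial>P)"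
        by (intro Bochner_Integration.integral_sum dh_int)
      also have "\<dots> = (\<Sum>j\<in>UNIV. \<Sum>r<n. \<Sum>s\<le>m. \<integral>w. (real (Suc r) * ?I r (slice (f (Suc r)) j k) w) *
          ?I s (slice (g s) j k) w \<partial>P)"
        unfolding d_def h_def
        by (intro sum.cong refl integral_sum_mult_sum L2_cmult multiple_integral_L2 square_summable_slice ff gg)
           auto
      also have "\<dots> = (\<Sum>j\<in>UNIV. \<Sum>r<n. \<Sum>s\<le>m. real (Suc r) *
          (\<integral>w. ?I r (slice (f (Suc r)) j k) w * ?I s (slice (g s) j k) w \<partial>P))"
        by (simp only: mult.assoc integral_mult_right_zero)
      also have "\<dots> = (\<Sum>r<n. \<Sum>j\<in>UNIV. \<Sum>s\<le>m. real (Suc r) *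
          (\<integral>w. ?I r (slice (f (Suc r)) j k) w * ?I s (slice (g s) j k) w \<partial>P))"
        by (rule sum.swap)
      also have "\<dots> = (\<Sum>r<n. \<Sum>s\<le>m. \<Sum>j\<in>UNIV. real (Suc r) *
          (\<integral>w. ?I r (slice (f (Suc r)) j k) w * ?I s (slice (g s) j k) w \<partial>P))"
        by (intro sum.cong refl sum.swap)
      finally show ?thesis .
    qed
    moreover have "((\<lambda>k. \<Sum>r<n. \<Sum>s\<le>m. \<Sum>j\<in>UNIV. real (Suc r) *
        (\<integral>w. ?I r (slice (f (Suc r)) j k) w * ?I s (slice (g s) j k) w \<partial>P)) has_sum
      (\<Sum>r<n. \<Sum>s\<le>m. \<integral>w. ?I (Suc r) (f (Suc r)) w * ?I (Suc s) (symmetrize (Suc s) (g s)) w \<partial>P)) UNIV"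
      by (intro has_sum_sum_finite multiple_integral_duality ff gg) auto
    moreover have "(\<Sum>r<n. \<Sum>s\<le>m. \<integral>w. ?I (Suc r) (f (Suc r)) w * ?I (Suc s) (symmetrize (Suc s) (g s)) w \<partial>P)
      = (\<integral>w. F w * \<delta> w \<partial>P)"
    proof -
      have "(\<integral>w. F w * \<delta> w \<partial>P) = (\<integral>w. (\<Sum>r\<le>n. ?I r (f r) w) * \<delta> w \<partial>P)"
      proof (rule integral_cong_AE)
        show "(\<lambda>w. F w * \<delta> w) \<in> borel_measurable P"
          by (intro borel_measurable_times L2_measurable F \<delta>_L2)
        show "(\<lambda>w. (\<Sum>r\<le>n. ?I r (f r) w) * \<delta> w) \<in> borel_measurable P"
          by (intro borel_measurable_times borel_measurable_sum L2_measurable multiple_integral_L2 ff \<delta>_L2) auto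
        show "AE w in P. F w * \<delta> w = (\<Sum>r\<le>n. ?I r (f r) w) * \<delta> w"
          using F_eq by eventually_elim simp
      qed
      also have "\<dots> = (\<Sum>r\<le>n. \<Sum>s\<le>m. \<integral>w. ?I r (f r) w * ?I (Suc s) (symmetrize (Suc s) (g s)) w \<partial>P)"
        unfolding \<delta>_def
        by (intro integral_sum_mult_sum multiple_integral_L2 square_summable_symmetrize ff gg) auto
      also have "\<dots> = (\<Sum>r<n. \<Sum>s\<le>m. \<integral>w. ?I (Suc r) (f (Suc r)) w * ?I (Suc s) (symmetrize (Suc s) (g s)) w \<partial>P)"
      proof -
        have "(\<Sum>s\<le>m. \<integral>w. ?I 0 (f 0) w * ?I (Suc s) (symmetrize (Suc s) (g s)) w \<partial>P) = 0"
          by (intro sum.neutral ballI multiple_integral_orthogonal square_summable_symmetrize ff gg) auto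
        thus ?thesis by (simp add: sum.atMost_shift)
      qed
      finally show ?thesis ..
    qed
    ultimately show ?thesis by (simp add: has_sum_imp_sums)
  qed
  ultimately show "(\<integral>w. (\<Sum>k. D k w \<bullet> G k w) \<partial>P) = (\<integral>w. F w * \<delta> w \<partial>P)"
    by (rule sums_unique2)
qed

end

theorem proposition8p2:
  fixes P :: "(nat \<Rightarrow> nat) measure"
    and v :: "nat \<Rightarrow> nat \<Rightarrow> (nat \<Rightarrow> nat) \<Rightarrow> real^'d::finite"
    and F :: "(nat \<Rightarrow> nat) \<Rightarrow> real"
    and G :: "nat \<Rightarrow> (nat \<Rightarrow> nat) \<Rightarrow> real^'d"
  assumes "obtuse_random_walk P v"
    and "F \<in> chaos_space P (walk v)"
    and "G \<in> process_space P (walk v)"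
  shows "(AE w in P. summable (\<lambda>k. gradient P (walk v) F k w \<bullet> G k w)) \<and>
    integrable P (\<lambda>w. \<Sum>k. gradient P (walk v) F k w \<bullet> G k w) \<and>
    integrable P (\<lambda>w. F w * divergence P (walk v) G w) \<and>
    (\<integral>w. (\<Sum>k. gradient P (walk v) F k w \<bullet> G k w) \<partial>P) = (\<integral>w. F w * divergence P (walk v) G w \<partial>P)"
proof -
  interpret obtuse_random_walk P v by (rule assms(1))
  obtain n f where nf: "(SOME (n, f). chaos_expansion P (walk v) F n f) = (n, f)" by (rule prod.exhaust)
  obtain m g where mg: "(SOME (m, g). process_expansion P (walk v) G m g) = (m, g)" by (rule prod.exhaust)
  have "\<exists>x. case x of (n, f) \<Rightarrow> chaos_expansion P (walk v) F n f"
    using assms(2) by (auto simp: chaos_space_def)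
  from someI_ex[OF this] have f: "chaos_expansion P (walk v) F n f" by (simp add: nf)
  have "\<exists>x. case x of (m, g) \<Rightarrow> process_expansion P (walk v) G m g"
    using assms(3) by (auto simp: process_space_def)
  from someI_ex[OF this] have g: "process_expansion P (walk v) G m g" by (simp add: mg)
  have F: "F \<in> L2 P" using assms(2) by (simp add: chaos_space_def)
  have "(\<lambda>(w, k). G k w) \<in> borel_measurable (P \<Otimes>\<^sub>M count_space UNIV)"
    using assms(3) by (simp add: process_space_def L2_def)
  hence G: "G k \<in> borel_measurable P" for k
    by (drule_tac measurable_Pair1[where y = k]) auto
  show ?thesis
    using expansion_duality[OF F G f g] by (simp add: gradient_def divergence_def nf mg)
qed

end
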